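(* Let the momentum covector be given by $\lambda_1(s)=\lambda_1(0)\cosh s-\lambda_5(0)\sinh s$, $\lambda_5(s)=\lambda_5(0)\cosh s-\lambda_1(0)\sinh s$, $\lambda_2(s)=\lambda_2(0)\cosh s+\lambda_4(0)\sinh s$, $\lambda_4(s)=\lambda_4(0)\cosh s+\lambda_2(0)\sinh s$, $\lambda_3(s)=\sqrt{1-|\lambda_4(s)|^2-|\lambda_5(s)|^2}$, where $\sum_{i=1}^3\lambda_i^2(0)\ne0$. Then the spatial part of the cuspless sub-Riemannian geodesics in $\mathbf{P_{mec}}$ is given by $$\mathbf x(s)=\tilde R(0)^T(\tilde{\mathbf x}(s)-\tilde{\mathbf x}(0)),$$ where $\tilde R(0)$ and $\tilde{\mathbf x}(s):=(\tilde x(s),\tilde y(s),\tilde z(s))$ are given in terms of $\underline\lambda^{(1)}(0)$ and $\underline\lambda^{(2)}(0)$, depending on several cases. For all cases with $\underline\lambda^{(1)}(0)\ne\underline\lambda^{(2)}(0)$ we have $$\tilde x(s)=\frac1{\mathfrak c}\int_0^s\lambda_3(\tau)\,d\tau=-\frac{i\sqrt{1-d}\sqrt{1+\mathfrak c^2}}{\mathfrak c\sqrt2}\Big(E\big((s+\tfrac\varphi2)i,M\big)-E\big(\tfrac\varphi2i,M\big)\Big),$$ where $M:=\frac{2d}{d-1}$, $d:=\frac{\|\underline\lambda^{(2)}(0)+\underline\lambda^{(1)}(0)\|\,\|\underline\lambda^{(2)}(0)-\underline\lambda^{(1)}(0)\|}{1+\mathfrak c^2}\le1$, and $\varphi:=\log\frac{\|\underline\lambda^{(2)}(0)+\underline\lambda^{(1)}(0)\|}{\|\underline\lambda^{(2)}(0)-\underline\lambda^{(1)}(0)\|}$.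 For the case $\underline\lambda^{(1)}(0)=\mathbf 0$, we have $$\tilde R(0)=\begin{pmatrix}0&0&1\\0&1&0\\-1&0&0\end{pmatrix}\in SO(3),\qquad\begin{pmatrix}\tilde y(s)\\\tilde z(s)\end{pmatrix}=\frac{-1}{\mathfrak c}\begin{pmatrix}\lambda_4(s)\\\lambda_5(s)\end{pmatrix}.$$ For the case $\underline\lambda^{(1)}(0)\ne\mathbf 0$, we have $$\tilde R(0)=\frac1{\mathfrak c}\begin{pmatrix}\lambda_1(0)&\lambda_2(0)&\lambda_3(0)\\ \mathfrak c\frac{-\lambda_2(0)}{\|\underline\lambda^{(1)}(0)\|}&\mathfrak c\frac{\lambda_1(0)}{\|\underline\lambda^{(1)}(0)\|}&0\\ \frac{-\lambda_1(0)\lambda_3(0)}{\|\underline\lambda^{(1)}(0)\|}&\frac{-\lambda_2(0)\lambda_3(0)}{\|\underline\lambda^{(1)}(0)\|}&\|\underline\lambda^{(1)}(0)\|\end{pmatrix}\in SO(3).$$ For the case $W=0$ along with $\underline\lambda^{(1)}(0)\ne\mathbf 0$, we have $$\begin{pmatrix}\tilde y(s)\\\tilde z(s)\end{pmatrix}=\frac{\underline\lambda^{(2)}(s)\cdot\underline\lambda^{(1)}(0)}{\mathfrak c\|\underline\lambda^{(1)}(0)\|}\begin{pmatrix}0\\1\end{pmatrix}.$$ For $W\ne0$ along with $\underline\lambda^{(1)}(0)\ne\mathbf 0$, we have $$\begin{pmatrix}\tilde y(s)\\\tilde z(s)\end{pmatrix}=\frac{\sqrt{\|\underline\lambda^{(2)}(s)\|^2-W^2\mathfrak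 c^{-2}}}{\mathfrak c^2\|\underline\lambda^{(1)}(0)\|\sqrt{\|\underline\lambda^{(2)}(0)\|^2-W^2\mathfrak c^{-2}}}\begin{pmatrix}\cos\tilde\psi(s)&-\sin\tilde\psi(s)\\\sin\tilde\psi(s)&\cos\tilde\psi(s)\end{pmatrix}\begin{pmatrix}W\lambda_3(0)\\\mathfrak c(\underline\lambda^{(2)}(0)\cdot\underline\lambda^{(1)}(0))\end{pmatrix},$$ where $$\begin{aligned}\tilde\psi(s)&=\int_0^s\frac{W\mathfrak c^{-1}\lambda_3(\tau)}{\|\underline\lambda^{(2)}(\tau)\|^2-W^2\mathfrak c^{-2}}\,d\tau\\&=-\frac W{\mathfrak c}\frac{\sqrt2}{\sqrt{1+\mathfrak c^2}\sqrt{1-d}}\frac1i\Big(F\big(i(s+\tfrac\varphi2),M\big)-F\big(\tfrac{i\varphi}2,M\big)-\big(1-\tfrac1D\big)\Big(\Pi\big(\tfrac MD,i(s+\tfrac\varphi2),M\big)-\Pi\big(\tfrac MD,\tfrac{i\varphi}2,M\big)\Big)\Big),\end{aligned}$$ with $D=2(\frac{W^2}{\mathfrak c^2}-1)(1+\mathfrak c^2)^{-1}(1-d)^{-1}+1$ and $|\tilde\psi(s)|<\pi$, $\mathrm{sign}(\tilde\psi(s))=\mathrm{sign}(W)$.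
   Context: $SE(3)=\mathbb R^3\rtimes SO(3)$ carries the sub-Riemannian structure with distribution spanned by the left-invariant vector fields $\mathcal A_3,\mathcal A_4,\mathcal A_5$ generating translation along the $z$-axis and rotations about the $x$- and $y$-axis, taken orthonormal. $\mathbf{P_{mec}}$ is the induced length-minimization problem on the quotient $SE(3)/(\{\mathbf 0\}\times SO(2))$ ($SO(2)$ being the rotations about the $z$-axis); its geodesics come from those solutions of the Pontryagin Maximum Principle on $SE(3)$ whose sixth momentum component $\lambda_6$ vanishes. They depart from $e=(\mathbf 0,I)$, and a geodesic is cuspless if its spatial projection has no cusp; it is then parametrized by spatial arclength $s\in[0,s_{max}]$. The momentum is normalized by $\lambda_3^2+\lambda_4^2+\lambda_5^2=1$, with $\lambda_3(0)\ge 0$; $s_{max}$ is the minimal $s>0$ with $\lambda_3(s)=0$ ($s_{max}=\infty$ if there is none). The geodesic $\gamma(s)=(\mathbf x(s),R(s))$ satisfies $\gamma(0)=(\mathbf 0,I)$ and, where $\lambda_3(s)>0$, $$\mathbf x'(s)=R(s)\mathbf e_z,\qquad R'(s)=\frac1{\lambda_3(s)}R(s)\begin{pmatrix}0&0&\lambda_5(s)\\0&0&-\lambda_4(s)\\-\lambda_5(s)&\lambda_4(s)&0\end{pmatrix},$$ with $\lambda_i(s)$ as in the claim. The spatial part is $\mathbf x(\cdot)$. Notation: $\underline\lambda^{(1)}=(-\lambda_1,-\lambda_2)$, $\underline\lambda^{(2)}=(\lambda_5,-\lambda_4)$; the quantities $W=-\lambda_2\lambda_5-\lambda_1\lambda_4$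 and $\mathfrak c=\sqrt{\|\underline\lambda^{(1)}\|^2-\|\underline\lambda^{(2)}\|^2+1}=\sqrt{\lambda_1^2+\lambda_2^2+\lambda_3^2}$ are constant along the curve. Elliptic integrals: $F(\phi,m)=\int_0^\phi(1-m\sin^2\theta)^{-1/2}d\theta$, $E(\phi,m)=\int_0^\phi(1-m\sin^2\theta)^{1/2}d\theta$, $\Pi(n,\phi,m)=\int_0^\phi(1-m\sin^2\theta)^{-1/2}(1-n\sin^2\theta)^{-1}d\theta$.
   Formalization: The elliptic-integral expression for x̃ is stated only when also λ⁽¹⁾(0) ≠ −λ⁽²⁾(0), since otherwise φ = log 0 is undefined; sign(ψ̃(s)) = sign(W) is stated for s > 0, since ψ̃(0) = 0. *)

theory Defs
  imports "HOL-Complex_Analysis.Complex_Analysis"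
begin

text \<open>
  A momentum curve is a function \<open>l :: real \<Rightarrow> real^6\<close>, where \<open>l s $ i\<close> is the \<open>i\<close>-th component
  (for \<open>i = 1, \<dots>, 6\<close>) of the momentum covector with respect to the left-invariant frame of
  \<open>SE(3)\<close>, at spatial arclength \<open>s\<close>.
\<close>

definition lam1 :: "(real \<Rightarrow> real^6) \<Rightarrow> real \<Rightarrow> real^2" where
  "lam1 l s = vector [- (l s $ 1), - (l s $ 2)]"

definition lam2 :: "(real \<Rightarrow> real^6) \<Rightarrow> real \<Rightarrow> real^2" where
  "lam2 l s = vector [l s $ 5, - (l s $ 4)]"

text \<open>The following two quantities are conserved along the curve and are evaluated at \<open>s = 0\<close>.\<close>

definition W_const :: "(real \<Rightarrow> real^6) \<Rightarrow> real" where
  "W_const l = - (l 0 $ 2) * (l 0 $ 5) - (l 0 $ 1) * (l 0 $ 4)"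

definition c_const :: "(real \<Rightarrow> real^6) \<Rightarrow> real" where
  "c_const l = sqrt ((norm (lam1 l 0))\<^sup>2 - (norm (lam2 l 0))\<^sup>2 + 1)"

text \<open>
  The infimum is \<open>\<infinity>\<close> if \<open>\<lambda>\<^sub>3\<close> has no positive zero. The parameter interval is \<open>[0, s_max]\<close>, which
  means \<open>[0, \<infinity>)\<close> in that case.
\<close>

definition s_max :: "(real \<Rightarrow> real^6) \<Rightarrow> ereal" where
  "s_max l = (INF s\<in>{s. 0 < s \<and> l s $ 3 = 0}. ereal s)"

definition arc_domain :: "(real \<Rightarrow> real^6) \<Rightarrow> real set" where
  "arc_domain l = {s. 0 \<le> s \<and> ereal s \<le> s_max l}"

text \<open>
  The curve \<open>s \<mapsto> (x s, R s)\<close> in \<open>SE(3)\<close>, departing from the unit element, that is driven by the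
  momentum \<open>l\<close>: its velocity is \<open>A\<^sub>3 + (\<lambda>\<^sub>4 / \<lambda>\<^sub>3) A\<^sub>4 + (\<lambda>\<^sub>5 / \<lambda>\<^sub>3) A\<^sub>5\<close> for the left-invariant
  fields \<open>A\<^sub>3\<close> (translation along the z-axis) and \<open>A\<^sub>4\<close>, \<open>A\<^sub>5\<close> (rotations about the x- and
  y-axis). Where \<open>\<lambda>\<^sub>3 = 0\<close>, which can only occur at the ends of the interval, the equations
  are singular and only continuity is required.
\<close>

definition cuspless_geodesic ::
  "(real \<Rightarrow> real^6) \<Rightarrow> (real \<Rightarrow> real^3) \<Rightarrow> (real \<Rightarrow> real^3^3) \<Rightarrow> bool" where
  "cuspless_geodesic l x R \<longleftrightarrow>
     x 0 = 0 \<and> R 0 = mat 1 \<and>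
     (\<forall>s\<in>arc_domain l. rotation_matrix (R s)) \<and>
     continuous_on (arc_domain l) x \<and> continuous_on (arc_domain l) R \<and>
     (\<forall>s\<in>arc_domain l. l s $ 3 > 0 \<longrightarrow>
        (x has_vector_derivative (R s *v axis 3 1)) (at s within arc_domain l) \<and>
        (R has_vector_derivative
           ((1 / l s $ 3) *\<^sub>R
             (R s ** vector [vector [0, 0, l s $ 5],
                             vector [0, 0, - (l s $ 4)],
                             vector [- (l s $ 5), l s $ 4, 0]]))) (at s within arc_domain l))"

text \<open>
  Incomplete elliptic integrals with complex amplitude; the path of integration is the line
  segment from \<open>0\<close> to the amplitude, and roots are principal.
\<close>

definition elliptic_F :: "complex \<Rightarrow> complex \<Rightarrow> complex" where
  "elliptic_F \<phi> m = contour_integral (linepath 0 \<phi>) (\<lambda>\<theta>. 1 / csqrt (1 - m * (sin \<theta>)\<^sup>2))"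

definition elliptic_E :: "complex \<Rightarrow> complex \<Rightarrow> complex" where
  "elliptic_E \<phi> m = contour_integral (linepath 0 \<phi>) (\<lambda>\<theta>. csqrt (1 - m * (sin \<theta>)\<^sup>2))"

definition elliptic_Pi :: "complex \<Rightarrow> complex \<Rightarrow> complex \<Rightarrow> complex" where
  "elliptic_Pi n \<phi> m = contour_integral (linepath 0 \<phi>)
     (\<lambda>\<theta>. 1 / (csqrt (1 - m * (sin \<theta>)\<^sup>2) * (1 - n * (sin \<theta>)\<^sup>2)))"

definition d_const :: "(real \<Rightarrow> real^6) \<Rightarrow> real" where
  "d_const l = norm (lam2 l 0 + lam1 l 0) * norm (lam2 l 0 - lam1 l 0) / (1 + (c_const l)\<^sup>2)"

definition M_const :: "(real \<Rightarrow> real^6) \<Rightarrow> real" where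
  "M_const l = 2 * d_const l / (d_const l - 1)"

definition phi_const :: "(real \<Rightarrow> real^6) \<Rightarrow> real" where
  "phi_const l = ln (norm (lam2 l 0 + lam1 l 0) / norm (lam2 l 0 - lam1 l 0))"

definition D_const :: "(real \<Rightarrow> real^6) \<Rightarrow> real" where
  "D_const l =
     2 * ((W_const l)\<^sup>2 / (c_const l)\<^sup>2 - 1) / ((1 + (c_const l)\<^sup>2) * (1 - d_const l)) + 1"

definition x_tilde :: "(real \<Rightarrow> real^6) \<Rightarrow> real \<Rightarrow> real" where
  "x_tilde l s = (1 / c_const l) * integral {0..s} (\<lambda>\<tau>. l \<tau> $ 3)"

definition psi_tilde :: "(real \<Rightarrow> real^6) \<Rightarrow> real \<Rightarrow> real" where
  "psi_tilde l s = integral {0..s}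
     (\<lambda>\<tau>. (W_const l / c_const l * (l \<tau> $ 3)) /
           ((norm (lam2 l \<tau>))\<^sup>2 - (W_const l)\<^sup>2 / (c_const l)\<^sup>2))"

definition yz_tilde :: "(real \<Rightarrow> real^6) \<Rightarrow> real \<Rightarrow> real^2" where
  "yz_tilde l s =
    (let c = c_const l; W = W_const l; n = norm (lam1 l 0); \<psi> = psi_tilde l s in
     if lam1 l 0 = 0 then (- 1 / c) *\<^sub>R vector [l s $ 4, l s $ 5]
     else if W = 0 then ((lam2 l s \<bullet> lam1 l 0) / (c * n)) *\<^sub>R vector [0, 1]
     else (sqrt ((norm (lam2 l s))\<^sup>2 - W\<^sup>2 / c\<^sup>2) /
            (c\<^sup>2 * n * sqrt ((norm (lam2 l 0))\<^sup>2 - W\<^sup>2 / c\<^sup>2))) *\<^sub>R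
          ((vector [vector [cos \<psi>, - sin \<psi>], vector [sin \<psi>, cos \<psi>]] :: real^2^2) *v
            vector [W * (l 0 $ 3), c * (lam2 l 0 \<bullet> lam1 l 0)]))"

definition curve_tilde :: "(real \<Rightarrow> real^6) \<Rightarrow> real \<Rightarrow> real^3" where
  "curve_tilde l s = vector [x_tilde l s, yz_tilde l s $ 1, yz_tilde l s $ 2]"

definition R_tilde :: "(real \<Rightarrow> real^6) \<Rightarrow> real^3^3" where
  "R_tilde l =
    (let c = c_const l; n = norm (lam1 l 0) in
     if lam1 l 0 = 0
     then vector [vector [0, 0, 1],
                  vector [0, 1, 0],
                  vector [- 1, 0, 0]]
     else (1 / c) *\<^sub>R
          vector [vector [l 0 $ 1, l 0 $ 2, l 0 $ 3],
                  vector [c * (- (l 0 $ 2) / n), c * (l 0 $ 1 / n), 0],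
                  vector [- (l 0 $ 1) * (l 0 $ 3) / n, - (l 0 $ 2) * (l 0 $ 3) / n, n]])"

end

theory Submission
  imports Defs
begin

text \<open>
  Along the geodesic the linear momentum \<open>R \<mu>\<close> and the angular momentum \<open>R \<nu> + x \<times> R \<mu>\<close> are constant,
  where \<open>\<mu> = (\<lambda>\<^sub>1, \<lambda>\<^sub>2, \<lambda>\<^sub>3)\<close> and \<open>\<nu> = (\<lambda>\<^sub>4, \<lambda>\<^sub>5, 0)\<close>. The second law determines the part of \<open>x\<close>
  orthogonal to \<open>\<mu>(0)\<close> from \<open>R \<nu>\<close>, and \<open>(x \<bullet> \<mu>(0))' = \<lambda>\<^sub>3\<close> gives the remaining component. The projection
  of \<open>R \<nu>\<close> along \<open>\<mu>(0)\<close> is a planar curve; its radius and its angular velocity \<open>\<psi>'\<close> are explicit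
  functions of the momentum.

  For the elliptic integrals, \<open>\<parallel>\<lambda>\<^sup>(\<^sup>2\<^sup>)(s)\<parallel>\<^sup>2 = 1 - K + P sinh\<^sup>2 (s + \<phi>/2)\<close> with constants \<open>K, P > 0\<close> such that
  \<open>M = - P / K\<close>, and \<open>sinh y\<close> is the sine on the imaginary axis up to the factor \<open>\<i>\<close>.
\<close>

section \<open>Hyperbolic norms and integrals along the imaginary axis\<close>

no_notation fps_nth (infixl \<open>$\<close> 75)

text \<open>Write the vector as \<open>(exp s (u + v) + exp (- s) (u - v)) / 2\<close>. Its squared
  norm involves \<open>norm (u + v)^2 exp (2 s) + norm (u - v)^2 exp (- 2 s)\<close>, and
  \<open>\<phi>\<close> is the shift that balances both coefficients to \<open>P\<close>, giving
  \<open>2 P cosh (2 s + \<phi>)\<close>. The proof expands this by the addition theorem.\<close>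

lemma norm_sq_hyperbolic_combination:
  fixes u v :: "'a::real_inner"
  assumes "u \<noteq> v" "u \<noteq> - v"
  defines "P \<equiv> norm (u + v) * norm (u - v)"
    and "\<phi> \<equiv> ln (norm (u + v) / norm (u - v))"
  shows "(norm (cosh s *\<^sub>R u + sinh s *\<^sub>R v))\<^sup>2 =
    ((norm u)\<^sup>2 - (norm v)\<^sup>2 + P) / 2 + P * (sinh (s + \<phi> / 2))\<^sup>2"
proof -
  define a b where "a = norm (u + v)" and "b = norm (u - v)"
  have pos: "a > 0" "b > 0"
    using assms(1,2) by (auto simp: a_def b_def add_eq_0_iff2)
  have a2: "a\<^sup>2 = (norm u)\<^sup>2 + 2 * (u \<bullet> v) + (norm v)\<^sup>2"
    and b2: "b\<^sup>2 = (norm u)\<^sup>2 - 2 * (u \<bullet> v) + (norm v)\<^sup>2"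
    unfolding a_def b_def power2_norm_eq_inner by (simp_all add: algebra_simps inner_commute)
  have e: "exp \<phi> = a / b"
    using pos by (simp add: \<phi>_def a_def b_def)
  have Pc: "P * cosh \<phi> = (a\<^sup>2 + b\<^sup>2) / 2" and Ps: "P * sinh \<phi> = (a\<^sup>2 - b\<^sup>2) / 2"
    using pos by (simp_all add: P_def cosh_def sinh_def exp_minus e flip: a_def b_def)
      (simp_all add: field_simps power2_eq_square)
  have "2 * (sinh (s + \<phi> / 2))\<^sup>2 = cosh (2 * s + \<phi>) - 1"
    using cosh_double[of "s + \<phi> / 2"] cosh_square_eq[of "s + \<phi> / 2"] by (simp add: algebra_simps)
  then have "2 * (P * (sinh (s + \<phi> / 2))\<^sup>2) + P = P * cosh (2 * s + \<phi>)"
    by (metis (no_types, opaque_lifting) diff_add_cancel distrib_left mult.left_commute mult_1_right)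
  also have "\<dots> = cosh (2 * s) * (P * cosh \<phi>) + sinh (2 * s) * (P * sinh \<phi>)"
    by (simp add: cosh_add algebra_simps)
  also have "\<dots> = (1 + 2 * (sinh s)\<^sup>2) * ((norm u)\<^sup>2 + (norm v)\<^sup>2) + 4 * sinh s * cosh s * (u \<bullet> v)"
    unfolding Pc Ps a2 b2 by (simp only: cosh_double sinh_double cosh_square_eq) (simp add: field_simps)
  finally have *: "2 * (P * (sinh (s + \<phi> / 2))\<^sup>2) + P =
    (1 + 2 * (sinh s)\<^sup>2) * ((norm u)\<^sup>2 + (norm v)\<^sup>2) + 4 * sinh s * cosh s * (u \<bullet> v)" .
  have "(norm (cosh s *\<^sub>R u + sinh s *\<^sub>R v))\<^sup>2 =
    (cosh s)\<^sup>2 * (norm u)\<^sup>2 + (sinh s)\<^sup>2 * (norm v)\<^sup>2 + 2 * cosh s * sinh s * (u \<bullet> v)"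
    unfolding power2_norm_eq_inner
    by (simp add: algebra_simps power2_eq_square inner_commute)
  then show ?thesis
    using * by (simp add: cosh_square_eq field_simps)
qed

text \<open>On the axis \<open>d\<theta> = \<i> dy\<close>. Both amplitudes are joined to 0, which
  may lie before, between or after them; hence the hull of 0, \<open>a\<close> and \<open>b\<close>
  and the case distinction. Integrability is assumed instead of continuity because integrands of the
  first and third kind may be unbounded at an end.\<close>

lemma contour_integral_imaginary_difference:
  fixes f :: "complex \<Rightarrow> complex" and h :: "real \<Rightarrow> real"
  assumes "a \<le> b" and int: "h integrable_on {min 0 a..max 0 b}"
    and f: "\<And>y. y \<in> {min 0 a..max 0 b} \<Longrightarrow> f (\<i> * y) = h y"
  shows "contour_integral (linepath 0 (\<i> * b)) f - contour_integral (linepath 0 (\<i> * a)) f =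
    \<i> * integral {a..b} h"
proof -
  have int': "h integrable_on {p..q}" if "min 0 a \<le> p" "q \<le> max 0 b" for p q
    using integrable_subinterval_real[OF int] that by auto
  have seg: "contour_integral (linepath (\<i> * p) (\<i> * q)) f = \<i> * integral {p..q} h"
    if "min 0 a \<le> p" "p \<le> q" "q \<le> max 0 b" for p q :: real
  proof (cases "p = q")
    case False
    have "contour_integral (linepath (\<i> * p) (\<i> * q)) f =
        \<i> * integral {p..q} (\<lambda>y. f (Complex 0 y))"
      using that False by (intro contour_integral_linepath_same_Re) auto
    also have "integral {p..q} (\<lambda>y. f (Complex 0 y)) = integral {p..q} (\<lambda>y. complex_of_real (h y))"
    proof (rule integral_cong)
      fix y assume "y \<in> {p..q}"
      moreover have "Complex 0 y = \<i> * y"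
        by (simp add: complex_eq_iff)
      ultimately show "f (Complex 0 y) = complex_of_real (h y)"
        using that f by auto
    qed
    also have "\<dots> = complex_of_real (integral {p..q} h)"
      using integral_linear[OF int'[of p q] bounded_linear_of_real[where 'a = complex]] that
      by (simp add: o_def)
    finally show ?thesis .
  qed auto
  \<comment> \<open>Towards a negative amplitude the segment runs downwards, so the path is reversed
    before \<open>seg\<close> applies.\<close>
  have neg: "contour_integral (linepath 0 (\<i> * p)) f = - (\<i> * integral {p..0} h)"
    if "min 0 a \<le> p" "p \<le> 0" for p :: real
  proof -
    have "contour_integral (linepath 0 (\<i> * p)) f = - contour_integral (linepath (\<i> * p) 0) f"
      using contour_integral_reversepath[of "linepath (\<i> * p) 0" f] by simp
    also have "\<dots> = - (\<i> * integral {p..0} h)"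
      using seg[of p 0] that by simp
    finally show ?thesis .
  qed
  have combine: "complex_of_real (integral {p..q} h) + of_real (integral {q..r} h) = of_real (integral {p..r} h)"
    if "min 0 a \<le> p" "p \<le> q" "q \<le> r" "r \<le> max 0 b" for p q r
    using Henstock_Kurzweil_Integration.integral_combine[of p q r h] int'[of p r] that
    by (simp flip: of_real_add)
  consider "0 \<le> a" | "a < 0" "0 \<le> b" | "b < 0"
    by linarith
  then show ?thesis
  proof cases
    case 1
    with \<open>a \<le> b\<close> have "complex_of_real (integral {0..b} h) = of_real (integral {0..a} h) + of_real (integral {a..b} h)"
      by (subst combine) auto
    then show ?thesis
      using seg[of 0 a] seg[of 0 b] 1 \<open>a \<le> b\<close> by (simp add: distrib_left)
  next
    case 2
    then have "complex_of_real (integral {a..b} h) = of_real (integral {a..0} h) + of_real (integral {0..b} h)"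
      by (subst combine) auto
    then show ?thesis
      using neg[of a] seg[of 0 b] 2 by (simp add: distrib_left)
  next
    case 3
    with \<open>a \<le> b\<close> have "complex_of_real (integral {a..0} h) = of_real (integral {a..b} h) + of_real (integral {b..0} h)"
      by (subst combine) auto
    then show ?thesis
      using neg[of a] neg[of b] 3 \<open>a \<le> b\<close> by (simp add: distrib_left)
  qed
qed

text \<open>The integrand may be unbounded at the ends of the interval; it is compared with the
  derivative of \<open>arcsin (k sinh y)\<close>, where \<open>k\<^sup>2 = m\<close>.\<close>

lemma integrable_inverse_sqrt_sinh:
  fixes m Y :: real
  assumes m: "m > 0" and Y: "0 \<le> Y" "m * (sinh Y)\<^sup>2 \<le> 1" and h: "continuous_on {-Y..Y} h"
  shows "(\<lambda>y. h y / sqrt (1 - m * (sinh y)\<^sup>2)) integrable_on {-Y..Y}"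
proof -
  define k where "k = sqrt m"
  have k: "k > 0" "k\<^sup>2 = m" using m by (simp_all add: k_def)
  have kY: "k * sinh Y \<le> 1"
    using power2_le_imp_le[of "k * sinh Y" 1] Y k by (simp add: power_mult_distrib)
  have bd: "\<bar>k * sinh y\<bar> \<le> k * sinh Y" if "y \<in> {-Y..Y}" for y
    using that k by (cases "y \<ge> 0") (simp_all add: abs_mult flip: sinh_minus)
  have bd': "\<bar>k * sinh y\<bar> < k * sinh Y" if "y \<in> {-Y<..<Y}" for y
    using that k by (cases "y \<ge> 0") (simp_all add: abs_mult flip: sinh_minus)
  define g where "g y = k * cosh y / sqrt (1 - m * (sinh y)\<^sup>2)" for y
  have "(g has_integral arcsin (k * sinh Y) - arcsin (k * sinh (-Y))) {-Y..Y}"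
  \<comment> \<open>If \<open>m (sinh Y)^2 = 1\<close>, the arcsine is not differentiable at the
    ends, so only its continuity is used there.\<close>
  proof (rule fundamental_theorem_of_calculus_interior)
    show "continuous_on {-Y..Y} (\<lambda>y. arcsin (k * sinh y))"
      using bd kY by (intro continuous_intros) (force simp: abs_le_iff)+
  next
    fix y assume y: "y \<in> {-Y<..<Y}"
    have "((\<lambda>y. arcsin (k * sinh y)) has_real_derivative g y) (at y)"
      using order.strict_trans2[OF bd'[OF y] kY] k unfolding g_def
      by (auto intro!: derivative_eq_intros simp: power_mult_distrib abs_less_iff field_simps)
    then show "((\<lambda>y. arcsin (k * sinh y)) has_vector_derivative g y) (at y)"
      by (simp add: has_real_derivative_iff_has_vector_derivative)
  qed (use Y in auto)
  moreover have "g y \<ge> 0" if "y \<in> {-Y..Y}" for y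
  proof -
    have "(k * sinh y)\<^sup>2 \<le> 1" using bd[OF that] kY by (auto simp: abs_square_le_1)
    then show ?thesis using k by (simp add: g_def power_mult_distrib)
  qed
  \<comment> \<open>A nonnegative integrable function is absolutely integrable, and this survives
    multiplication by the bounded continuous factor below.\<close>
  ultimately have "g absolutely_integrable_on {-Y..Y}"
    by (intro nonnegative_absolutely_integrable_1) auto
  moreover have cont: "continuous_on {-Y..Y} (\<lambda>y. h y / (k * cosh y))"
    using k by (intro continuous_intros h) auto
  ultimately have "(\<lambda>y. h y / (k * cosh y) * g y) absolutely_integrable_on {-Y..Y}"
    using compact_imp_bounded[OF compact_continuous_image[OF cont]]
    by (intro absolutely_integrable_bounded_measurable_product_real
        continuous_imp_measurable_on_sets_lebesgue) auto
  then have "(\<lambda>y. h y / (k * cosh y) * g y) integrable_on {-Y..Y}"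
    by (simp add: absolutely_integrable_on_def)
  then show ?thesis
    using k by (simp add: g_def)
qed

section \<open>Domain and invariants of the momentum curve\<close>

locale momentum_curve =
  fixes l :: "real \<Rightarrow> real^6"
  assumes l1: "\<And>s. l s $ 1 = (l 0 $ 1) * cosh s - (l 0 $ 5) * sinh s"
    and l5: "\<And>s. l s $ 5 = (l 0 $ 5) * cosh s - (l 0 $ 1) * sinh s"
    and l2: "\<And>s. l s $ 2 = (l 0 $ 2) * cosh s + (l 0 $ 4) * sinh s"
    and l4: "\<And>s. l s $ 4 = (l 0 $ 4) * cosh s + (l 0 $ 2) * sinh s"
    and l3: "\<And>s. l s $ 3 = sqrt (1 - (l s $ 4)\<^sup>2 - (l s $ 5)\<^sup>2)"
    and nonzero: "(l 0 $ 1)\<^sup>2 + (l 0 $ 2)\<^sup>2 + (l 0 $ 3)\<^sup>2 \<noteq> 0"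
    and normalized: "\<And>s. s \<in> arc_domain l \<Longrightarrow> (l s $ 3)\<^sup>2 + (l s $ 4)\<^sup>2 + (l s $ 5)\<^sup>2 = 1"
begin

abbreviation "\<c> \<equiv> c_const l"
abbreviation "\<W> \<equiv> W_const l"
abbreviation "\<phi> \<equiv> phi_const l"

lemma norm_lam1: "(norm (lam1 l s))\<^sup>2 = (l s $ 1)\<^sup>2 + (l s $ 2)\<^sup>2"
  and norm_lam2: "(norm (lam2 l s))\<^sup>2 = (l s $ 4)\<^sup>2 + (l s $ 5)\<^sup>2"
  by (simp_all add: lam1_def lam2_def norm_vec_def L2_set_def sum_2)

lemma lam2_hyperbolic: "lam2 l s = cosh s *\<^sub>R lam2 l 0 + sinh s *\<^sub>R lam1 l 0"
  by (simp add: vec_eq_iff forall_2 lam1_def lam2_def l4[of s] l5[of s])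

lemma zero_in_domain: "0 \<in> arc_domain l"
  by (auto simp: arc_domain_def s_max_def intro!: INF_greatest)

lemma domain_nonneg: "s \<in> arc_domain l \<Longrightarrow> 0 \<le> s"
  by (simp add: arc_domain_def)

lemma domain_segment: "s \<in> arc_domain l \<Longrightarrow> {0..s} \<subseteq> arc_domain l"
  by (auto simp: arc_domain_def) (meson ereal_less_eq(3) order_trans)

lemma l3_sq: "s \<in> arc_domain l \<Longrightarrow> (l s $ 3)\<^sup>2 = 1 - (norm (lam2 l s))\<^sup>2"
  using normalized[of s] by (simp add: norm_lam2)

text \<open>\<open>sqrt\<close> of a negative real is negative in HOL; it is
  \<open>normalized\<close> that makes the radicand in \<open>l3\<close> nonnegative on the
  domain.\<close>

lemma l3_nonneg: "s \<in> arc_domain l \<Longrightarrow> 0 \<le> l s $ 3"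
  using normalized[of s] zero_le_power2[of "l s $ 3"]
  by (subst l3, intro real_sqrt_ge_zero) linarith

text \<open>The domain stops at the first positive zero, so a zero is possible only at the two
  ends.\<close>

lemma l3_pos:
  assumes "s \<in> arc_domain l" "0 < t" "t < s"
  shows "0 < l t $ 3"
proof -
  have "l t $ 3 \<noteq> 0"
  proof
    assume "l t $ 3 = 0"
    with \<open>0 < t\<close> have "s_max l \<le> ereal t"
      unfolding s_max_def by (intro INF_lower) auto
    then show False
      using assms by (auto simp: arc_domain_def) (meson ereal_less_eq(3) leD order_trans)
  qed
  moreover have "t \<in> arc_domain l"
    using domain_segment[OF assms(1)] assms by auto
  ultimately show ?thesis
    using l3_nonneg[of t] by simp
qed

text \<open>Normalization at 0 turns the radicand of \<open>c_const\<close> into a sum of squares,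
  so the root is genuine, and \<open>nonzero\<close> makes it positive.\<close>

lemma c_sq: "\<c>\<^sup>2 = (l 0 $ 1)\<^sup>2 + (l 0 $ 2)\<^sup>2 + (l 0 $ 3)\<^sup>2"
  and c_sq': "\<c>\<^sup>2 = (norm (lam1 l 0))\<^sup>2 - (norm (lam2 l 0))\<^sup>2 + 1"
  and c_pos: "0 < \<c>"
proof -
  have eq: "(l 0 $ 1)\<^sup>2 + (l 0 $ 2)\<^sup>2 + (l 0 $ 3)\<^sup>2 =
      (norm (lam1 l 0))\<^sup>2 - (norm (lam2 l 0))\<^sup>2 + 1"
    using normalized[OF zero_in_domain] by (simp add: norm_lam1 norm_lam2)
  moreover have "0 \<le> (l 0 $ 1)\<^sup>2 + (l 0 $ 2)\<^sup>2 + (l 0 $ 3)\<^sup>2"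
    by simp
  ultimately have "0 \<le> (norm (lam1 l 0))\<^sup>2 - (norm (lam2 l 0))\<^sup>2 + 1"
    by linarith
  then show c: "\<c>\<^sup>2 = (norm (lam1 l 0))\<^sup>2 - (norm (lam2 l 0))\<^sup>2 + 1"
    by (simp add: c_const_def)
  then show c': "\<c>\<^sup>2 = (l 0 $ 1)\<^sup>2 + (l 0 $ 2)\<^sup>2 + (l 0 $ 3)\<^sup>2"
    using eq by simp
  then have "\<c> \<noteq> 0"
    using nonzero by auto
  moreover have "0 \<le> \<c>"
    unfolding c_const_def using \<open>0 \<le> _ - _ + 1\<close> by (rule real_sqrt_ge_zero)
  ultimately show "0 < \<c>"
    by simp
qed

end

section \<open>Hyperbolic sine form of \<open>\<lambda>\<^sub>3\<close>\<close>

locale generic_momentum_curve = momentum_curve +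
  assumes generic: "lam1 l 0 \<noteq> lam2 l 0" "lam1 l 0 \<noteq> - lam2 l 0"
begin

text \<open>\<open>K\<close> and \<open>P\<close> are the coefficients in
  \<open>K - P sinh\<^sup>2 (s + \<phi>/2)\<close>, the form of the square of
  \<open>\<lambda>\<^sub>3\<close> on the domain; \<open>K\<close> is the maximum of this expression
  over the real line.\<close>

definition P :: real where "P = norm (lam2 l 0 + lam1 l 0) * norm (lam2 l 0 - lam1 l 0)"
definition K :: real where "K = (1 + \<c>\<^sup>2 - P) / 2"

text \<open>\<open>generic\<close> makes both factors nonzero; it likewise keeps the quotient inside
  the logarithm of \<open>phi_const\<close> positive.\<close>

lemma P_pos: "0 < P"
  using generic by (auto simp: P_def add_eq_0_iff)

lemma norm_lam2_sinh: "(norm (lam2 l s))\<^sup>2 = 1 - K + P * (sinh (s + \<phi> / 2))\<^sup>2"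
proof -
  have "lam2 l 0 \<noteq> lam1 l 0" "lam2 l 0 \<noteq> - lam1 l 0"
    using generic by auto
  from norm_sq_hyperbolic_combination[OF this, of s] show ?thesis
    by (simp add: c_sq' K_def P_def phi_const_def flip: lam2_hyperbolic) (simp add: field_simps)
qed

lemma l3_sq_sinh: "s \<in> arc_domain l \<Longrightarrow> (l s $ 3)\<^sup>2 = K - P * (sinh (s + \<phi> / 2))\<^sup>2"
  by (simp add: l3_sq norm_lam2_sinh)

lemma sinh_bound:
  assumes "s \<in> arc_domain l"
  shows "P * (sinh (s + \<phi> / 2))\<^sup>2 \<le> K"
  using l3_sq_sinh[OF assms] zero_le_power2[of "l s $ 3"] by linarith

lemma l3_sinh:
  assumes "s \<in> arc_domain l"
  shows "l s $ 3 = sqrt (K - P * (sinh (s + \<phi> / 2))\<^sup>2)"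
  using l3_sq_sinh[OF assms] l3_nonneg[OF assms] by (metis real_sqrt_abs abs_of_nonneg)

text \<open>If \<open>K \<le> 0\<close>, then \<open>\<lambda>\<^sub>3\<close> vanishes at \<open>0\<close> only, so the domain is unbounded and the
  normalization is violated.\<close>

lemma K_pos: "0 < K"
proof (rule ccontr)
  assume "\<not> 0 < K"
  \<comment> \<open>At 0 the nonnegative left side of \<open>sinh_bound\<close> is at most
    \<open>K \<le> 0\<close>, so the phase must vanish.\<close>
  moreover from this sinh_bound[OF zero_in_domain] have "P * (sinh (\<phi> / 2))\<^sup>2 \<le> 0"
    by simp
  then have "\<phi> = 0"
    using P_pos by (simp add: mult_le_0_iff)
  moreover have "0 < P * (sinh s)\<^sup>2" if "0 < s" for s
    using P_pos that by simp
  ultimately have "1 < (norm (lam2 l s))\<^sup>2" if "0 < s" for s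
    using that \<open>\<not> 0 < K\<close> by (fastforce simp: norm_lam2_sinh)
  then have neg: "1 - (l s $ 4)\<^sup>2 - (l s $ 5)\<^sup>2 < 0" if "0 < s" for s
    using that by (force simp: norm_lam2)
  \<comment> \<open>\<open>sqrt\<close> vanishes only at 0, also on negative arguments. Hence the
    infimum in \<open>s_max\<close> is over the empty set, and 1 lies in the domain.\<close>
  have "l s $ 3 \<noteq> 0" if "0 < s" for s
    using neg[OF that] by (subst l3) simp
  then have empty: "{s. 0 < s \<and> l s $ 3 = 0} = {}"
    by auto
  have "1 \<in> arc_domain l"
    unfolding arc_domain_def s_max_def empty by simp
  then show False
    using normalized[of 1] neg[of 1] zero_le_power2[of "l 1 $ 3"] by linarith
qed

text \<open>\<open>d\<close> is \<open>P / (1 + c^2)\<close>, so \<open>M\<close> and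
  \<open>d\<close> merely rescale \<open>P\<close> and \<open>K\<close>, and \<open>d < 1\<close> is
  the positivity of \<open>K\<close>.\<close>

lemma K_eq: "K = (1 + \<c>\<^sup>2) * (1 - d_const l) / 2"
  and d_less_1: "d_const l < 1"
  and M_eq: "M_const l = - P / K"
proof -
  have c: "1 + \<c>\<^sup>2 > 0" by (simp add: add_pos_nonneg)
  have P: "P = (1 + \<c>\<^sup>2) * d_const l"
    using c by (simp add: P_def d_const_def)
  show K: "K = (1 + \<c>\<^sup>2) * (1 - d_const l) / 2"
    by (simp add: K_def P algebra_simps)
  show d: "d_const l < 1"
    using K_pos c by (simp add: K zero_less_mult_iff)
  show "M_const l = - P / K"
  proof -
    have "- P / K = - ((1 + \<c>\<^sup>2) * (2 * d_const l)) / ((1 + \<c>\<^sup>2) * (1 - d_const l))"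
      by (simp add: P K)
    also have "\<dots> = - (2 * d_const l / (1 - d_const l))"
      using c by (metis less_irrefl minus_divide_left mult_divide_mult_cancel_left)
    also have "\<dots> = M_const l"
      using d by (simp add: M_const_def field_simps)
    finally show ?thesis ..
  qed
qed

lemma sqrt_K: "sqrt (1 - d_const l) * sqrt (1 + \<c>\<^sup>2) / sqrt 2 = sqrt K"
  by (simp add: K_eq real_sqrt_mult real_sqrt_divide)

text \<open>The signs of the negative modulus and of the square of \<open>\<i>\<close> cancel, which
  leaves a real expression.\<close>

lemma modulus_sin: "complex_of_real (M_const l) * (sin (\<i> * complex_of_real y))\<^sup>2 =
    complex_of_real (P / K * (sinh y)\<^sup>2)"
proof -
  have "sin (\<i> * complex_of_real y) = \<i> * complex_of_real (sinh y)"
    unfolding sin_i_times sinh_field_def by (simp add: exp_minus exp_of_real)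
  then show ?thesis
    by (simp add: M_eq power_mult_distrib)
qed

text \<open>Half-length of the least interval symmetric about 0 that contains both integration ends;
  symmetry suits integrands that depend on \<open>sinh\<^sup>2 y\<close>.\<close>

definition reach :: "real \<Rightarrow> real" where "reach s = max \<bar>\<phi> / 2\<bar> \<bar>s + \<phi> / 2\<bar>"

lemma reach_nonneg: "0 \<le> reach s"
  by (simp add: reach_def)

lemma between_subset_reach: "0 \<le> s \<Longrightarrow> {min 0 (\<phi> / 2)..max 0 (s + \<phi> / 2)} \<subseteq> {- reach s..reach s}"
  by (rule subsetI) (auto simp: reach_def min_def max_def abs_if split: if_splits)

text \<open>\<open>reach s\<close> is the absolute value of the shifted parameter at 0 or at
  \<open>s\<close>, where \<open>sinh_bound\<close> applies, and \<open>sinh\<^sup>2 y\<close> grows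
  with the absolute value of \<open>y\<close>.\<close>

lemma sinh_bound_reach:
  assumes s: "s \<in> arc_domain l" and y: "y \<in> {- reach s..reach s}"
  shows "P / K * (sinh y)\<^sup>2 \<le> 1"
proof -
  have "P * (sinh (reach s))\<^sup>2 \<le> K"
    using sinh_bound[OF s] sinh_bound[OF zero_in_domain]
    by (cases "\<bar>\<phi> / 2\<bar> \<le> \<bar>s + \<phi> / 2\<bar>") (simp_all add: reach_def max_def del: abs_divide)
  moreover have "\<bar>sinh y\<bar> \<le> sinh (reach s)"
    using y by (auto simp flip: sinh_real_abs)
  then have "(sinh y)\<^sup>2 \<le> (sinh (reach s))\<^sup>2"
    using abs_le_square_iff[of "sinh y" "sinh (reach s)"] by linarith
  then have "P * (sinh y)\<^sup>2 \<le> P * (sinh (reach s))\<^sup>2"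
    using P_pos by simp
  ultimately have "P * (sinh y)\<^sup>2 \<le> K"
    by linarith
  then show ?thesis
    using K_pos by (simp add: field_simps)
qed

end

section \<open>Momentum equations in differential form\<close>

context momentum_curve
begin

lemma l4_deriv: "((\<lambda>s. l s $ 4) has_real_derivative l s $ 2) (at s)"
  and l5_deriv: "((\<lambda>s. l s $ 5) has_real_derivative - (l s $ 1)) (at s)"
  and l1_deriv: "((\<lambda>s. l s $ 1) has_real_derivative - (l s $ 5)) (at s)"
  and l2_deriv: "((\<lambda>s. l s $ 2) has_real_derivative l s $ 4) (at s)"
proof -
  have eqs: "(\<lambda>s. l s $ 1) = (\<lambda>s. (l 0 $ 1) * cosh s - (l 0 $ 5) * sinh s)"
    "(\<lambda>s. l s $ 5) = (\<lambda>s. (l 0 $ 5) * cosh s - (l 0 $ 1) * sinh s)"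
    "(\<lambda>s. l s $ 2) = (\<lambda>s. (l 0 $ 2) * cosh s + (l 0 $ 4) * sinh s)"
    "(\<lambda>s. l s $ 4) = (\<lambda>s. (l 0 $ 4) * cosh s + (l 0 $ 2) * sinh s)"
    by (rule ext, rule l1 l2 l4 l5)+
  show "((\<lambda>s. l s $ 4) has_real_derivative l s $ 2) (at s)"
    unfolding eqs by (subst l2) (auto intro!: derivative_eq_intros)
  show "((\<lambda>s. l s $ 5) has_real_derivative - (l s $ 1)) (at s)"
    unfolding eqs by (subst l1) (auto intro!: derivative_eq_intros)
  show "((\<lambda>s. l s $ 1) has_real_derivative - (l s $ 5)) (at s)"
    unfolding eqs by (subst l5) (auto intro!: derivative_eq_intros)
  show "((\<lambda>s. l s $ 2) has_real_derivative l s $ 4) (at s)"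
    unfolding eqs by (subst l4) (auto intro!: derivative_eq_intros)
qed

lemma continuous_l: "i \<in> {1, 2, 3, 4, 5} \<Longrightarrow> continuous_on S (\<lambda>s. l s $ i)"
proof -
  have c: "continuous_on S (\<lambda>s. l s $ 4)" "continuous_on S (\<lambda>s. l s $ 5)"
    "continuous_on S (\<lambda>s. l s $ 1)" "continuous_on S (\<lambda>s. l s $ 2)"
    using DERIV_isCont[OF l1_deriv] DERIV_isCont[OF l2_deriv]
      DERIV_isCont[OF l4_deriv] DERIV_isCont[OF l5_deriv]
    by (simp_all add: continuous_at_imp_continuous_on)
  have "(\<lambda>s. l s $ 3) = (\<lambda>s. sqrt (1 - (l s $ 4)\<^sup>2 - (l s $ 5)\<^sup>2))"
    by (rule ext, rule l3)
  then have "continuous_on S (\<lambda>s. l s $ 3)"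
    by (simp only:) (intro continuous_intros c)
  then show "i \<in> {1, 2, 3, 4, 5} \<Longrightarrow> continuous_on S (\<lambda>s. l s $ i)"
    using c by auto
qed

end

section \<open>Elliptic form of the coordinate along the linear momentum\<close>

context generic_momentum_curve
begin

text \<open>The root of Legendre's normal form, restricted to the imaginary axis.\<close>

definition h :: "real \<Rightarrow> real" where "h y = sqrt (1 - P / K * (sinh y)\<^sup>2)"

lemma continuous_h: "continuous_on S h"
  unfolding h_def by (intro continuous_intros)

text \<open>By \<open>sinh_bound_reach\<close> the radicand is a nonnegative real, where the
  principal complex root is the real one.\<close>

lemma csqrt_modulus:
  assumes "s \<in> arc_domain l" "y \<in> {- reach s..reach s}"
  shows "csqrt (1 - complex_of_real (M_const l) * (sin (\<i> * complex_of_real y))\<^sup>2) = h y"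
proof -
  have "1 - complex_of_real (P / K * (sinh y)\<^sup>2) = complex_of_real (1 - P / K * (sinh y)\<^sup>2)"
    by (simp only: of_real_diff of_real_1)
  then show ?thesis
    using sinh_bound_reach[OF assms] unfolding modulus_sin h_def
    by (simp only: csqrt_of_real diff_ge_0_iff_ge)
qed

lemma l3_h:
  assumes "s \<in> arc_domain l"
  shows "l s $ 3 = sqrt K * h (s + \<phi> / 2)"
proof -
  have "K - P * (sinh (s + \<phi> / 2))\<^sup>2 = K * (1 - P / K * (sinh (s + \<phi> / 2))\<^sup>2)"
    using K_pos by (simp add: right_diff_distrib)
  then show ?thesis
    unfolding l3_sinh[OF assms] h_def by (simp only: real_sqrt_mult)
qed

text \<open>Used with \<open>g = 1\<close> for \<open>x_tilde\<close> and with the reciprocal of the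
  denominator of \<open>\<psi>'\<close> for \<open>psi_tilde\<close>.\<close>

lemma integral_l3_shift:
  assumes s: "s \<in> arc_domain l" and g: "continuous_on {\<phi> / 2..s + \<phi> / 2} g"
  shows "integral {0..s} (\<lambda>\<tau>. l \<tau> $ 3 * g (\<tau> + \<phi> / 2)) =
    sqrt K * integral {\<phi> / 2..s + \<phi> / 2} (\<lambda>y. h y * g y)"
proof -
  have "integral {0..s} (\<lambda>\<tau>. l \<tau> $ 3 * g (\<tau> + \<phi> / 2)) =
      integral {0..s} (\<lambda>\<tau>. sqrt K * (h (\<tau> + \<phi> / 2) * g (\<tau> + \<phi> / 2)))"
    using domain_segment[OF s] by (intro integral_cong) (auto simp: l3_h)
  also have "\<dots> = sqrt K * integral {0..s} ((\<lambda>y. h y * g y) \<circ> (\<lambda>\<tau>. \<tau> + \<phi> / 2))"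
    by (simp add: o_def)
  also have "integral {0..s} ((\<lambda>y. h y * g y) \<circ> (\<lambda>\<tau>. \<tau> + \<phi> / 2)) =
      integral {0 + \<phi> / 2..s + \<phi> / 2} (\<lambda>y. h y * g y)"
    using g by (intro integral_shift continuous_on_mult continuous_h) simp
  finally show ?thesis by simp
qed

text \<open>By \<open>l3_h\<close> the integrand is \<open>sqrt K\<close> times that of the second
  kind; the factor \<open>- \<i>\<close> undoes \<open>d\<theta> = \<i> dy\<close>.\<close>

lemma x_tilde_elliptic:
  assumes s: "s \<in> arc_domain l"
  shows "complex_of_real (x_tilde l s) =
    - (\<i> * complex_of_real (sqrt (1 - d_const l) * sqrt (1 + \<c>\<^sup>2) / (\<c> * sqrt 2))) *
      (elliptic_E (complex_of_real (s + \<phi> / 2) * \<i>) (complex_of_real (M_const l)) -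
       elliptic_E (complex_of_real (\<phi> / 2) * \<i>) (complex_of_real (M_const l)))"
proof -
  have "elliptic_E (\<i> * complex_of_real (s + \<phi> / 2)) (complex_of_real (M_const l)) -
      elliptic_E (\<i> * complex_of_real (\<phi> / 2)) (complex_of_real (M_const l)) =
      \<i> * integral {\<phi> / 2..s + \<phi> / 2} h"
    unfolding elliptic_E_def
  proof (rule contour_integral_imaginary_difference)
    show "h integrable_on {min 0 (\<phi> / 2)..max 0 (s + \<phi> / 2)}"
      by (intro integrable_continuous_real continuous_h)
  next
    fix y assume "y \<in> {min 0 (\<phi> / 2)..max 0 (s + \<phi> / 2)}"
    then have "y \<in> {- reach s..reach s}"
      using between_subset_reach domain_nonneg[OF s] by blast
    then show "csqrt (1 - complex_of_real (M_const l) * (sin (\<i> * complex_of_real y))\<^sup>2) = h y"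
      by (rule csqrt_modulus[OF s])
  qed (use domain_nonneg[OF s] in simp)
  moreover have "x_tilde l s = sqrt K / \<c> * integral {\<phi> / 2..s + \<phi> / 2} h"
    using integral_l3_shift[OF s, of "\<lambda>_. 1"] by (simp add: x_tilde_def)
  moreover have "sqrt (1 - d_const l) * sqrt (1 + \<c>\<^sup>2) / (\<c> * sqrt 2) = sqrt K / \<c>"
    by (simp flip: sqrt_K)
  moreover have "- (\<i> * a) * (\<i> * b) = a * b" for a b
    by (simp add: algebra_simps)
  ultimately show ?thesis
    by (simp only: mult.commute[of _ \<i>] of_real_mult)
qed

section \<open>Elliptic form, bound and sign of the polar angle\<close>

definition A :: real where "A = 1 - K - \<W>\<^sup>2 / \<c>\<^sup>2"

text \<open>\<open>W\<close> is the determinant of \<open>u\<close> and \<open>v\<close>, and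
  Lagrange's identity turns \<open>P^2 - (norm u^2 - norm v^2)^2\<close> into \<open>4 W^2\<close>.
  The right side is this difference of squares in factored form.\<close>

lemma W_sq: "\<W>\<^sup>2 = (1 - K) * (P + K - 1)"
proof -
  define u v where "u = lam2 l 0" and "v = lam1 l 0"
  have P2: "P\<^sup>2 = (norm (u + v))\<^sup>2 * (norm (u - v))\<^sup>2"
    by (simp add: P_def u_def v_def power_mult_distrib)
  have uv: "u $ 1 = l 0 $ 5" "u $ 2 = - (l 0 $ 4)" "v $ 1 = - (l 0 $ 1)" "v $ 2 = - (l 0 $ 2)"
    by (simp_all add: u_def v_def lam1_def lam2_def)
  have "1 - \<c>\<^sup>2 = (norm u)\<^sup>2 - (norm v)\<^sup>2"
    by (simp add: c_sq' u_def v_def)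
  then have "P\<^sup>2 - (1 - \<c>\<^sup>2)\<^sup>2 = 4 * \<W>\<^sup>2"
    by (simp only: P2) (simp add: norm_vec_def L2_set_def sum_2 W_const_def uv,
       simp add: power2_eq_square algebra_simps)
  then show ?thesis
    by (simp add: K_def field_simps power2_eq_square)
qed

text \<open>The left side is the squared radius of the planar curve and the denominator of
  \<open>\<psi>'\<close>; \<open>A\<close> is its least value over the real line.\<close>

lemma norm_lam2_minus: "(norm (lam2 l s))\<^sup>2 - \<W>\<^sup>2 / \<c>\<^sup>2 = A + P * (sinh (s + \<phi> / 2))\<^sup>2"
  by (simp add: norm_lam2_sinh A_def)

lemma D_eq: "D_const l = - A / K"
proof -
  have "2 * (\<W>\<^sup>2 / \<c>\<^sup>2 - 1) / ((1 + \<c>\<^sup>2) * (1 - d_const l)) = (\<W>\<^sup>2 / \<c>\<^sup>2 - 1) / K"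
    by (simp add: K_eq)
  then show ?thesis
    using K_pos by (simp add: D_const_def A_def field_simps)
qed

text \<open>Insert \<open>W_sq\<close> and \<open>c^2 = 2 K + P - 1\<close>. The product form
  reduces the positivity of \<open>A\<close> to \<open>K < 1\<close>.\<close>

lemma A_eq: "A = (1 - K) * K / \<c>\<^sup>2"
proof -
  have "A * \<c>\<^sup>2 = (1 - K) * \<c>\<^sup>2 - \<W>\<^sup>2"
    using c_pos by (simp add: A_def left_diff_distrib)
  also have "\<dots> = (1 - K) * K"
    by (simp add: W_sq K_def field_simps)
  finally show ?thesis
    using c_pos by (simp add: field_simps)
qed

context
  assumes W: "\<W> \<noteq> 0"
begin

text \<open>The factors in \<open>W_sq\<close> have a positive product and the positive sum
  \<open>P\<close>, so both are positive.\<close>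

lemma K_less_1: "K < 1" and P_K_gt_1: "1 < P + K"
proof -
  have "0 < \<W>\<^sup>2" using W by simp
  then have "0 < (1 - K) * (P + K - 1)" by (simp add: W_sq)
  with P_pos show "K < 1" "1 < P + K" by (auto simp: zero_less_mult_iff)
qed

lemma A_pos: "0 < A"
  using K_less_1 K_pos c_pos by (simp add: A_eq)

lemma denom_pos: "0 < A + P * (sinh y)\<^sup>2"
  using A_pos P_pos by (simp add: add_pos_nonneg)

lemma psi_tilde_eq:
  "psi_tilde l s = \<W> / \<c> * integral {0..s} (\<lambda>\<tau>. l \<tau> $ 3 * (1 / (A + P * (sinh (\<tau> + \<phi> / 2))\<^sup>2)))"
  unfolding psi_tilde_def norm_lam2_minus
  by (simp only: integral_mult_right[symmetric]) simp

lemma continuous_denom: "continuous_on S (\<lambda>y. 1 / (A + P * (sinh (y + t))\<^sup>2))"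
  using denom_pos by (intro continuous_intros) (metis less_irrefl)

text \<open>Partial fractions: for \<open>N = A + P sinh\<^sup>2 y\<close> one has
  \<open>K h^2 + N = A + K\<close>, hence \<open>K h / N = (A + K) / (N h) - 1 / h\<close>, a
  combination of integrands of the third and the first kind.\<close>

lemma psi_tilde_elliptic:
  assumes s: "s \<in> arc_domain l"
  defines "M \<equiv> complex_of_real (M_const l)" and "D \<equiv> complex_of_real (D_const l)"
  shows "complex_of_real (psi_tilde l s) =
     - complex_of_real (\<W> / \<c> * (sqrt 2 / (sqrt (1 + \<c>\<^sup>2) * sqrt (1 - d_const l)))) * (1 / \<i>) *
       (elliptic_F (\<i> * complex_of_real (s + \<phi> / 2)) M -
        elliptic_F (\<i> * complex_of_real \<phi> / 2) M -
        (1 - 1 / D) *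
          (elliptic_Pi (M / D) (\<i> * complex_of_real (s + \<phi> / 2)) M -
           elliptic_Pi (M / D) (\<i> * complex_of_real \<phi> / 2) M))"
proof -
  \<comment> \<open>The reciprocal of the factor \<open>1 - n sin\<^sup>2 \<theta>\<close> of the
    third kind on the axis, for \<open>n = M / D = P / A\<close>.\<close>
  define p where "p y = 1 / (1 + P / A * (sinh y)\<^sup>2)" for y
  have p_pos: "0 < p y" for y
    using P_pos A_pos by (simp add: p_def add_pos_nonneg)
  \<comment> \<open>\<open>1 / h\<close> is unbounded if \<open>\<lambda>\<^sub>3\<close> vanishes
    at 0 or at \<open>s\<close>, so integrability comes from the arcsine comparison.\<close>
  have int: "(\<lambda>y. q y / h y) integrable_on {- reach s..reach s}"
    if "continuous_on {- reach s..reach s} q" for q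
    unfolding h_def using P_pos K_pos that sinh_bound_reach[OF s, of "reach s"] reach_nonneg
    by (intro integrable_inverse_sqrt_sinh) auto
  have cont_p: "continuous_on S p" for S
    unfolding p_def using P_pos A_pos
    by (intro continuous_intros) (metis add_pos_nonneg divide_pos_pos less_irrefl less_imp_le
        mult_nonneg_nonneg zero_le_power2 zero_less_one)
  have sub: "{min 0 (\<phi> / 2)..max 0 (s + \<phi> / 2)} \<subseteq> {- reach s..reach s}"
    using between_subset_reach domain_nonneg[OF s] by blast
  have ab: "\<phi> / 2 \<le> s + \<phi> / 2"
    using domain_nonneg[OF s] by simp
  have n: "M / D = complex_of_real (P / A)"
    using K_pos A_pos by (simp add: M_def D_def M_eq D_eq)
  have half: "\<i> * complex_of_real \<phi> / 2 = \<i> * complex_of_real (\<phi> / 2)"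
    by simp
  have sin: "1 - M / D * (sin (\<i> * complex_of_real y))\<^sup>2 = complex_of_real (1 / p y)" for y
  proof -
    have "M / D * (sin (\<i> * complex_of_real y))\<^sup>2 = complex_of_real (P / K * (sinh y)\<^sup>2) / D"
      using modulus_sin[of y] by (simp add: M_def)
    also have "\<dots> = complex_of_real (- (P / A * (sinh y)\<^sup>2))"
      using K_pos A_pos by (simp add: D_def D_eq)
    finally show ?thesis by (simp add: p_def)
  qed
  have F: "elliptic_F (\<i> * complex_of_real (s + \<phi> / 2)) M -
      elliptic_F (\<i> * complex_of_real (\<phi> / 2)) M =
      \<i> * integral {\<phi> / 2..s + \<phi> / 2} (\<lambda>y. 1 / h y)"
    unfolding elliptic_F_def
  proof (rule contour_integral_imaginary_difference[OF ab])
    show "(\<lambda>y. 1 / h y) integrable_on {min 0 (\<phi> / 2)..max 0 (s + \<phi> / 2)}"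
      by (rule integrable_subinterval_real[OF int sub]) simp
  next
    fix y assume "y \<in> {min 0 (\<phi> / 2)..max 0 (s + \<phi> / 2)}"
    then show "1 / csqrt (1 - M * (sin (\<i> * complex_of_real y))\<^sup>2) = complex_of_real (1 / h y)"
      using csqrt_modulus[OF s subsetD[OF sub]] by (simp add: M_def)
  qed
  have Pi: "elliptic_Pi (M / D) (\<i> * complex_of_real (s + \<phi> / 2)) M -
      elliptic_Pi (M / D) (\<i> * complex_of_real (\<phi> / 2)) M =
      \<i> * integral {\<phi> / 2..s + \<phi> / 2} (\<lambda>y. p y / h y)"
    unfolding elliptic_Pi_def
  proof (rule contour_integral_imaginary_difference[OF ab])
    show "(\<lambda>y. p y / h y) integrable_on {min 0 (\<phi> / 2)..max 0 (s + \<phi> / 2)}"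
      by (rule integrable_subinterval_real[OF int[OF cont_p] sub])
  next
    fix y assume "y \<in> {min 0 (\<phi> / 2)..max 0 (s + \<phi> / 2)}"
    then show "1 / (csqrt (1 - M * (sin (\<i> * complex_of_real y))\<^sup>2) *
        (1 - M / D * (sin (\<i> * complex_of_real y))\<^sup>2)) = complex_of_real (p y / h y)"
      using csqrt_modulus[OF s subsetD[OF sub]] by (subst sin) (simp add: M_def)
  qed
  have sub': "{\<phi> / 2..s + \<phi> / 2} \<subseteq> {- reach s..reach s}"
    using sub by auto
  have i1: "(\<lambda>y. 1 / h y) integrable_on {\<phi> / 2..s + \<phi> / 2}"
    by (rule integrable_subinterval_real[OF int sub']) simp
  have i2: "(\<lambda>y. p y / h y) integrable_on {\<phi> / 2..s + \<phi> / 2}"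
    by (rule integrable_subinterval_real[OF int[OF cont_p] sub'])
  have "integral {\<phi> / 2..s + \<phi> / 2} (\<lambda>y. 1 / h y) -
      (1 + K / A) * integral {\<phi> / 2..s + \<phi> / 2} (\<lambda>y. p y / h y) =
      integral {\<phi> / 2..s + \<phi> / 2} (\<lambda>y. 1 / h y - (1 + K / A) * (p y / h y))"
    by (simp only: integral_diff[OF i1 integrable_on_mult_right[OF i2]] integral_mult_right)
  also have "\<dots> = integral {\<phi> / 2..s + \<phi> / 2} (\<lambda>y. - K * (h y * (1 / (A + P * (sinh y)\<^sup>2))))"
  proof (rule integral_cong)
    fix y assume "y \<in> {\<phi> / 2..s + \<phi> / 2}"
    then have "P / K * (sinh y)\<^sup>2 \<le> 1"
      using sinh_bound_reach[OF s] sub' by auto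
    then have h2: "(h y)\<^sup>2 = 1 - P / K * (sinh y)\<^sup>2"
      by (simp add: h_def)
    define N where "N = A + P * (sinh y)\<^sup>2"
    have N: "N > 0" "p y = A / N"
      using denom_pos[of y] A_pos by (simp_all add: N_def p_def field_simps)
    have "1 - (1 + K / A) * p y = (N - A - K) / N"
      unfolding N(2) using N(1) A_pos by (simp add: field_simps)
    also have "N - A - K = - K * (h y)\<^sup>2"
      using K_pos by (simp add: h2 N_def right_diff_distrib)
    finally have *: "1 - (1 + K / A) * p y = - K * (h y)\<^sup>2 / N" .
    have "1 / h y - (1 + K / A) * (p y / h y) = (1 - (1 + K / A) * p y) / h y"
      by (simp add: diff_divide_distrib)
    \<comment> \<open>At an end with \<open>h y = 0\<close> both sides are 0, because division by 0
      yields 0.\<close>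
    also have "\<dots> = - K * (h y * (1 / N))"
      unfolding * by (simp add: power2_eq_square)
    finally show "1 / h y - (1 + K / A) * (p y / h y) = - K * (h y * (1 / (A + P * (sinh y)\<^sup>2)))"
      by (simp add: N_def)
  qed
  also have "\<dots> = - K * integral {\<phi> / 2..s + \<phi> / 2} (\<lambda>y. h y * (1 / (A + P * (sinh y)\<^sup>2)))"
    by (simp only: integral_mult_right)
  finally have comb: "integral {\<phi> / 2..s + \<phi> / 2} (\<lambda>y. 1 / h y) -
      (1 + K / A) * integral {\<phi> / 2..s + \<phi> / 2} (\<lambda>y. p y / h y) =
      - K * integral {\<phi> / 2..s + \<phi> / 2} (\<lambda>y. h y * (1 / (A + P * (sinh y)\<^sup>2)))" .
  have psi: "psi_tilde l s = \<W> / \<c> * (sqrt K *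
      integral {\<phi> / 2..s + \<phi> / 2} (\<lambda>y. h y * (1 / (A + P * (sinh y)\<^sup>2))))"
    unfolding psi_tilde_eq using continuous_denom[of _ 0]
    by (subst integral_l3_shift[OF s]) auto
  have "1 - 1 / D = complex_of_real (1 + K / A)"
    using A_pos K_pos by (simp add: D_def D_eq)
  then have diff: "\<i> * complex_of_real a - (1 - 1 / D) * (\<i> * complex_of_real b) =
      \<i> * complex_of_real (a - (1 + K / A) * b)" for a b
    by (simp add: right_diff_distrib mult.left_commute)
  \<comment> \<open>The prefactor is \<open>1 / sqrt K\<close>; together with the \<open>K\<close>
    of the partial fractions it gives the \<open>sqrt K\<close> in \<open>psi\<close>.\<close>
  have "sqrt 2 / (sqrt (1 + \<c>\<^sup>2) * sqrt (1 - d_const l)) = 1 / sqrt K"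
    by (simp flip: sqrt_K add: mult.commute)
  moreover have "- (\<W> / \<c> * (1 / sqrt K) * (- K * J)) = \<W> / \<c> * (K / sqrt K * J)" for J
    by simp
  moreover have "- complex_of_real a * (1 / \<i>) * (\<i> * complex_of_real b) =
      complex_of_real (- (a * b))" for a b
    by (simp add: algebra_simps)
  ultimately have "complex_of_real (\<W> / \<c> * (sqrt K * J)) =
      - complex_of_real (\<W> / \<c> * (sqrt 2 / (sqrt (1 + \<c>\<^sup>2) * sqrt (1 - d_const l)))) *
        (1 / \<i>) * (\<i> * complex_of_real (- K * J))" for J
    using K_pos by (simp only: real_div_sqrt less_imp_le)
  then show ?thesis
    unfolding half F Pi diff comb psi .
qed

text \<open>By \<open>W_sq\<close> and \<open>A_eq\<close> the square of the left side is
  \<open>(P + K - 1) / P\<close>, which \<open>K < 1\<close> keeps below 1.\<close>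

lemma coefficient_le_1: "\<bar>\<W> / \<c>\<bar> * sqrt K / sqrt (A * P) \<le> 1"
proof -
  have "(\<bar>\<W> / \<c>\<bar> * sqrt K)\<^sup>2 = (1 - K) * K / \<c>\<^sup>2 * (P + K - 1)"
    using K_pos by (simp add: power_mult_distrib power_divide W_sq)
  also have "\<dots> \<le> A * P"
    unfolding A_eq[symmetric] using A_pos K_less_1 by (intro mult_left_mono) auto
  finally have "\<bar>\<W> / \<c>\<bar> * sqrt K \<le> sqrt (A * P)"
    by (rule real_le_rsqrt)
  moreover have "0 < sqrt (A * P)"
    using A_pos P_pos by simp
  ultimately show ?thesis
    by (metis divide_le_eq_1_pos)
qed

text \<open>The bound comes from comparing \<open>\<psi>'\<close>, via \<open>\<lambda>\<^sub>3 \<le> sqrt K cosh y\<close>, with the derivative of a multiple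
  of \<open>arctan (sqrt (P / A) sinh y)\<close>; the multiple is at most \<open>1\<close>.\<close>

lemma psi_tilde_abs_less_pi:
  assumes s: "s \<in> arc_domain l"
  shows "\<bar>psi_tilde l s\<bar> < pi"
proof -
  define k where "k = \<bar>\<W> / \<c>\<bar> * sqrt K / sqrt (A * P)"
  define r where "r = sqrt (P / A)"
  have r: "r\<^sup>2 = P / A" "0 < r"
    using A_pos P_pos by (simp_all add: r_def)
  have kr: "k * r = \<bar>\<W> / \<c>\<bar> * sqrt K / A"
  proof -
    have "sqrt (A * P) = A * r"
      using A_pos by (simp add: r_def real_sqrt_mult real_sqrt_divide field_simps)
    then show ?thesis
      using \<open>0 < r\<close> by (simp add: k_def)
  qed
  define g where "g \<tau> = \<bar>\<W> / \<c>\<bar> * sqrt K * cosh (\<tau> + \<phi> / 2) / (A + P * (sinh (\<tau> + \<phi> / 2))\<^sup>2)" for \<tau>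
  define \<Theta> where "\<Theta> \<tau> = k * arctan (r * sinh (\<tau> + \<phi> / 2))" for \<tau>
  have "(\<Theta> has_real_derivative g \<tau>) (at \<tau> within {0..s})" for \<tau>
  proof -
    have "((\<lambda>\<tau>. r * sinh (\<tau> + \<phi> / 2)) has_real_derivative r * cosh (\<tau> + \<phi> / 2))
        (at \<tau> within {0..s})"
      by (auto intro!: derivative_eq_intros)
    from DERIV_cmult[OF DERIV_chain2[OF DERIV_arctan this], of k]
    have "(\<Theta> has_real_derivative
        k * (r * cosh (\<tau> + \<phi> / 2) / (1 + (r * sinh (\<tau> + \<phi> / 2))\<^sup>2))) (at \<tau> within {0..s})"
      by (simp only: \<Theta>_def[abs_def] inverse_eq_divide times_divide_eq_left mult_1)
    also have "k * (r * cosh (\<tau> + \<phi> / 2) / (1 + (r * sinh (\<tau> + \<phi> / 2))\<^sup>2)) =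
        (k * r) * cosh (\<tau> + \<phi> / 2) / (1 + P / A * (sinh (\<tau> + \<phi> / 2))\<^sup>2)"
      by (simp add: power_mult_distrib r)
    also have "\<dots> = g \<tau>"
      using A_pos unfolding kr by (simp add: g_def distrib_left)
    finally show ?thesis .
  qed
  then have "(g has_integral \<Theta> s - \<Theta> 0) {0..s}"
    using domain_nonneg[OF s]
    by (intro fundamental_theorem_of_calculus) (auto simp: has_real_derivative_iff_has_vector_derivative)
  moreover have "norm (psi_tilde l s) \<le> integral {0..s} g"
    unfolding psi_tilde_def norm_lam2_minus
  proof (rule integral_norm_bound_integral)
    show "g integrable_on {0..s}"
      using calculation by blast
    show "(\<lambda>\<tau>. \<W> / \<c> * l \<tau> $ 3 / (A + P * (sinh (\<tau> + \<phi> / 2))\<^sup>2)) integrable_on {0..s}"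
      using continuous_on_mult[OF continuous_on_mult[OF continuous_on_const continuous_l]
          continuous_denom, of 3 "{0..s}" "\<W> / \<c>" "\<phi> / 2"]
      by (intro integrable_continuous_real) simp
  next
    fix \<tau> assume "\<tau> \<in> {0..s}"
    then have \<tau>: "\<tau> \<in> arc_domain l"
      using domain_segment[OF s] by blast
    have "h (\<tau> + \<phi> / 2) \<le> 1"
      using P_pos K_pos by (simp add: h_def)
    then have "l \<tau> $ 3 \<le> sqrt K * 1"
      unfolding l3_h[OF \<tau>] using K_pos by (intro mult_left_mono) auto
    also have "\<dots> \<le> sqrt K * cosh (\<tau> + \<phi> / 2)"
      using K_pos cosh_real_ge_1 by (intro mult_left_mono) auto
    finally have "\<bar>\<W> / \<c>\<bar> * l \<tau> $ 3 \<le> \<bar>\<W> / \<c>\<bar> * (sqrt K * cosh (\<tau> + \<phi> / 2))"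
      by (intro mult_left_mono) auto
    from divide_right_mono[OF this less_imp_le[OF denom_pos[of "\<tau> + \<phi> / 2"]]]
    show "norm (\<W> / \<c> * l \<tau> $ 3 / (A + P * (sinh (\<tau> + \<phi> / 2))\<^sup>2)) \<le> g \<tau>"
      using denom_pos[of "\<tau> + \<phi> / 2"] l3_nonneg[OF \<tau>]
      by (simp add: g_def abs_mult mult.assoc)
  qed
  ultimately have "\<bar>psi_tilde l s\<bar> \<le> \<Theta> s - \<Theta> 0"
    by (simp add: integral_unique)
  also have "\<dots> = k * (arctan (r * sinh (s + \<phi> / 2)) - arctan (r * sinh (\<phi> / 2)))"
    by (simp add: \<Theta>_def right_diff_distrib)
  \<comment> \<open>Both arctangents lie strictly between \<open>- pi / 2\<close> and
    \<open>pi / 2\<close>, and \<open>k\<close> is positive since \<open>W\<close> is nonzero; this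
    is where strictness enters.\<close>
  also have "\<dots> < k * pi"
  proof (rule mult_strict_left_mono)
    show "arctan (r * sinh (s + \<phi> / 2)) - arctan (r * sinh (\<phi> / 2)) < pi"
      using arctan_lbound[of "r * sinh (\<phi> / 2)"] arctan_ubound[of "r * sinh (s + \<phi> / 2)"]
      by linarith
    show "0 < k"
      using K_pos A_pos P_pos c_pos W by (simp add: k_def)
  qed
  also have "\<dots> \<le> pi"
    using mult_right_mono[OF coefficient_le_1[folded k_def], of pi] by simp
  finally show ?thesis .
qed

text \<open>Apart from the constant \<open>W / c\<close> the integrand is positive on the open
  interval, so possible zeros of \<open>\<lambda>\<^sub>3\<close> at the ends do no harm. At
  \<open>s = 0\<close> the angle is 0.\<close>

lemma sgn_psi_tilde:
  assumes s: "s \<in> arc_domain l" "0 < s"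
  shows "sgn (psi_tilde l s) = sgn \<W>"
proof -
  have "integral {0..s} (\<lambda>_. 0) <
      integral {0..s} (\<lambda>\<tau>. l \<tau> $ 3 * (1 / (A + P * (sinh (\<tau> + \<phi> / 2))\<^sup>2)))"
  proof (rule integral_less_real)
    show "continuous_on {0..s} (\<lambda>\<tau>. l \<tau> $ 3 * (1 / (A + P * (sinh (\<tau> + \<phi> / 2))\<^sup>2)))"
      by (intro continuous_on_mult continuous_l continuous_denom) auto
  qed (use s l3_pos[OF s(1)] denom_pos in auto)
  then show ?thesis
    using c_pos by (simp add: psi_tilde_eq sgn_mult)
qed

end

end

section \<open>Rotations and planar linear systems\<close>

lemma orthogonal_matrix_inner:
  fixes Q :: "real^'n^'n"
  assumes "orthogonal_matrix Q"
  shows "(Q *v v) \<bullet> (Q *v w) = v \<bullet> w"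
proof -
  have "orthogonal_transformation ((*v) Q)"
    by (simp add: orthogonal_transformation_matrix assms)
  then show ?thesis
    by (simp add: orthogonal_transformation_def)
qed

lemma bounded_bilinear_matrix_vector_mult:
  "bounded_bilinear ((*v) :: real^'n^'m \<Rightarrow> real^'n \<Rightarrow> real^'m)"
  unfolding bilinear_conv_bounded_bilinear[symmetric] bilinear_def
  by (auto intro!: linearI simp: algebra_simps scaleR_matrix_vector_assoc)

lemma inner_vector_3: "(v :: real^3) \<bullet> w = v $ 1 * w $ 1 + v $ 2 * w $ 2 + v $ 3 * w $ 3"
  by (simp add: inner_vec_def sum_3)

lemma cross3_components:
  "cross3 v w $ 1 = v $ 2 * w $ 3 - v $ 3 * w $ 2"
  "cross3 v w $ 2 = v $ 3 * w $ 1 - v $ 1 * w $ 3"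
  "cross3 v w $ 3 = v $ 1 * w $ 2 - v $ 2 * w $ 1"
  by (simp_all add: cross3_def)

text \<open>The system reads \<open>(Y + \<i> Z)' = (\<alpha> + \<i> \<beta>) (Y + \<i> Z)\<close>.\<close>

lemma scaled_rotation_unique:
  fixes Y Z \<psi> r \<alpha> \<beta> :: "real \<Rightarrow> real"
  assumes "a \<le> b"
    and cont: "continuous_on {a..b} Y" "continuous_on {a..b} Z"
      "continuous_on {a..b} \<psi>" "continuous_on {a..b} r"
    and r_pos: "\<And>t. t \<in> {a..b} \<Longrightarrow> 0 < r t"
    and Y: "\<And>t. a < t \<Longrightarrow> t < b \<Longrightarrow> (Y has_real_derivative \<alpha> t * Y t - \<beta> t * Z t) (at t)"
    and Z: "\<And>t. a < t \<Longrightarrow> t < b \<Longrightarrow> (Z has_real_derivative \<alpha> t * Z t + \<beta> t * Y t) (at t)"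
    and \<psi>: "\<And>t. a < t \<Longrightarrow> t < b \<Longrightarrow> (\<psi> has_real_derivative \<beta> t) (at t)"
    and r: "\<And>t. a < t \<Longrightarrow> t < b \<Longrightarrow> (r has_real_derivative \<alpha> t * r t) (at t)"
    and "\<psi> a = 0"
  shows "Y b = r b / r a * (cos (\<psi> b) * Y a - sin (\<psi> b) * Z a) \<and>
    Z b = r b / r a * (sin (\<psi> b) * Y a + cos (\<psi> b) * Z a)"
proof -
  \<comment> \<open>\<open>p + \<i> q\<close> is
    \<open>exp (- \<i> \<psi>) (Y + \<i> Z) / r\<close>: the claimed motion is undone, and what
    remains is constant.\<close>
  define p where "p t = (Y t * cos (\<psi> t) + Z t * sin (\<psi> t)) / r t" for t
  define q where "q t = (Z t * cos (\<psi> t) - Y t * sin (\<psi> t)) / r t" for t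
  have pq: "p b = p a \<and> q b = q a"
  proof (cases "a = b")
    case False
    with \<open>a \<le> b\<close> have "a < b" by simp
    have r_nz: "r t \<noteq> 0" if "t \<in> {a..b}" for t
      using r_pos[OF that] by simp
    have "p b = p a"
    proof (rule DERIV_isconst_end[OF \<open>a < b\<close>])
      show "continuous_on {a..b} p"
        unfolding p_def by (intro continuous_intros cont ballI r_nz)
      fix t assume t: "a < t" "t < b"
      have "(p has_real_derivative
        (((\<alpha> t * Y t - \<beta> t * Z t) * cos (\<psi> t) + Y t * (- sin (\<psi> t) * \<beta> t) +
          ((\<alpha> t * Z t + \<beta> t * Y t) * sin (\<psi> t) + Z t * (cos (\<psi> t) * \<beta> t))) * r t -
         (Y t * cos (\<psi> t) + Z t * sin (\<psi> t)) * (\<alpha> t * r t)) / (r t * r t)) (at t)"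
        unfolding p_def using r_nz[of t] t
        by (auto intro!: derivative_eq_intros Y[OF t] Z[OF t] \<psi>[OF t] r[OF t])
      also have "((\<alpha> t * Y t - \<beta> t * Z t) * cos (\<psi> t) + Y t * (- sin (\<psi> t) * \<beta> t) +
          ((\<alpha> t * Z t + \<beta> t * Y t) * sin (\<psi> t) + Z t * (cos (\<psi> t) * \<beta> t))) * r t -
         (Y t * cos (\<psi> t) + Z t * sin (\<psi> t)) * (\<alpha> t * r t) = 0"
        by (simp add: algebra_simps)
      finally show "(p has_real_derivative 0) (at t)"
        by simp
    qed
    moreover have "q b = q a"
    proof (rule DERIV_isconst_end[OF \<open>a < b\<close>])
      show "continuous_on {a..b} q"
        unfolding q_def by (intro continuous_intros cont ballI r_nz)
      fix t assume t: "a < t" "t < b"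
      have "(q has_real_derivative
        (((\<alpha> t * Z t + \<beta> t * Y t) * cos (\<psi> t) + Z t * (- sin (\<psi> t) * \<beta> t) -
          ((\<alpha> t * Y t - \<beta> t * Z t) * sin (\<psi> t) + Y t * (cos (\<psi> t) * \<beta> t))) * r t -
         (Z t * cos (\<psi> t) - Y t * sin (\<psi> t)) * (\<alpha> t * r t)) / (r t * r t)) (at t)"
        unfolding q_def using r_nz[of t] t
        by (auto intro!: derivative_eq_intros Y[OF t] Z[OF t] \<psi>[OF t] r[OF t])
      also have "((\<alpha> t * Z t + \<beta> t * Y t) * cos (\<psi> t) + Z t * (- sin (\<psi> t) * \<beta> t) -
          ((\<alpha> t * Y t - \<beta> t * Z t) * sin (\<psi> t) + Y t * (cos (\<psi> t) * \<beta> t))) * r t -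
         (Z t * cos (\<psi> t) - Y t * sin (\<psi> t)) * (\<alpha> t * r t) = 0"
        by (simp add: algebra_simps)
      finally show "(q has_real_derivative 0) (at t)"
        by simp
    qed
    ultimately show ?thesis ..
  qed auto
  have rb: "r b \<noteq> 0"
    using r_pos[of b] \<open>a \<le> b\<close> by simp
  have sc: "sin (\<psi> b) * sin (\<psi> b) + cos (\<psi> b) * cos (\<psi> b) = 1"
    using sin_cos_squared_add[of "\<psi> b"] by (simp add: power2_eq_square)
  have "r b * p b = Y b * cos (\<psi> b) + Z b * sin (\<psi> b)"
    "r b * q b = Z b * cos (\<psi> b) - Y b * sin (\<psi> b)"
    using rb by (simp_all add: p_def q_def)
  then have "Y b = r b * (cos (\<psi> b) * p b - sin (\<psi> b) * q b)"
    and "Z b = r b * (sin (\<psi> b) * p b + cos (\<psi> b) * q b)"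
    using sc by algebra+
  moreover have "p a = Y a / r a" "q a = Z a / r a"
    by (simp_all add: p_def q_def \<open>\<psi> a = 0\<close>)
  ultimately show "Y b = r b / r a * (cos (\<psi> b) * Y a - sin (\<psi> b) * Z a) \<and>
    Z b = r b / r a * (sin (\<psi> b) * Y a + cos (\<psi> b) * Z a)"
    using pq by (simp add: diff_divide_distrib add_divide_distrib right_diff_distrib distrib_left)
qed

lemma vector_deriv_vector_3:
  fixes f1 f2 f3 :: "real \<Rightarrow> real"
  assumes "(f1 has_real_derivative d1) (at t)" "(f2 has_real_derivative d2) (at t)"
    "(f3 has_real_derivative d3) (at t)"
  shows "((\<lambda>t. vector [f1 t, f2 t, f3 t] :: real^3) has_vector_derivative vector [d1, d2, d3]) (at t)"
proof -
  have eq: "vector [a, b, c] = a *\<^sub>R axis 1 1 + b *\<^sub>R axis 2 1 + c *\<^sub>R (axis 3 1 :: real^3)"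
    for a b c
    by (simp add: vec_eq_iff forall_3 axis_def)
  show ?thesis
    unfolding eq using assms
    by (auto intro!: derivative_eq_intros simp: has_real_derivative_iff_has_vector_derivative)
qed

lemma continuous_vector_3:
  fixes f1 f2 f3 :: "real \<Rightarrow> real"
  assumes "continuous_on S f1" "continuous_on S f2" "continuous_on S f3"
  shows "continuous_on S (\<lambda>t. vector [f1 t, f2 t, f3 t] :: real^3)"
proof -
  have eq: "vector [a, b, c] = a *\<^sub>R axis 1 1 + b *\<^sub>R axis 2 1 + c *\<^sub>R (axis 3 1 :: real^3)"
    for a b c
    by (simp add: vec_eq_iff forall_3 axis_def)
  show ?thesis
    unfolding eq by (intro continuous_intros assms)
qed

section \<open>Conservation laws along the geodesic\<close>

locale spatial_geodesic = momentum_curve +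
  fixes x :: "real \<Rightarrow> real^3" and R :: "real \<Rightarrow> real^3^3"
  assumes geodesic: "cuspless_geodesic l x R"
begin

text \<open>\<open>mu\<close> and \<open>nu\<close> are the linear and angular momentum in the moving frame, where \<open>\<lambda>\<^sub>6 = 0\<close>;
  in the fixed frame they yield the conservation laws \<open>R_mu\<close> and \<open>R_nu\<close> below.\<close>

definition mu :: "real \<Rightarrow> real^3" where "mu s = vector [l s $ 1, l s $ 2, l s $ 3]"
definition nu :: "real \<Rightarrow> real^3" where "nu s = vector [l s $ 4, l s $ 5, 0]"
definition nu' :: "real \<Rightarrow> real^3" where "nu' s = vector [l s $ 2, - (l s $ 1), 0]"

text \<open>The matrix of the cross product with \<open>nu s\<close>; the angular velocity of
  \<open>R\<close> in the moving frame is \<open>nu s\<close> divided by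
  \<open>\<lambda>\<^sub>3\<close>.\<close>

definition Omega :: "real \<Rightarrow> real^3^3" where
  "Omega s = vector [vector [0, 0, l s $ 5], vector [0, 0, - (l s $ 4)],
     vector [- (l s $ 5), l s $ 4, 0]]"

lemma Omega_mult: "Omega s *v v = vector [l s $ 5 * v $ 3, - (l s $ 4 * v $ 3),
    l s $ 4 * v $ 2 - l s $ 5 * v $ 1]"
  by (simp add: Omega_def matrix_vector_mult_def vec_eq_iff forall_3 sum_3)

lemma x_0: "x 0 = 0" and R_0: "R 0 = mat 1"
  and rotation_R: "s \<in> arc_domain l \<Longrightarrow> rotation_matrix (R s)"
  and continuous_x: "continuous_on (arc_domain l) x"
  and continuous_R: "continuous_on (arc_domain l) R"
  using geodesic by (simp_all add: cuspless_geodesic_def)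

lemma at_interior:
  fixes f :: "real \<Rightarrow> 'b::real_normed_vector"
  assumes s: "s \<in> arc_domain l" "0 < t" "t < s"
    and f: "(f has_vector_derivative D) (at t within arc_domain l)"
  shows "(f has_vector_derivative D) (at t)"
proof -
  have "{0<..<s} \<subseteq> arc_domain l"
    using domain_segment[OF s(1)] by (auto intro: subsetD)
  then have "(f has_vector_derivative D) (at t within {0<..<s})"
    by (rule has_vector_derivative_within_subset[OF f])
  then show ?thesis
    using s by (simp add: at_within_open[of t "{0<..<s}"])
qed

lemma derivatives:
  assumes s: "s \<in> arc_domain l" "0 < t" "t < s"
  shows "(x has_vector_derivative R t *v axis 3 1) (at t)"
    and "(R has_vector_derivative (1 / l t $ 3) *\<^sub>R (R t ** Omega t)) (at t)"
proof -
  have "t \<in> arc_domain l"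
    using domain_segment[OF s(1)] s by auto
  moreover have "0 < l t $ 3"
    by (rule l3_pos[OF s])
  ultimately have "(x has_vector_derivative R t *v axis 3 1) (at t within arc_domain l) \<and>
      (R has_vector_derivative (1 / l t $ 3) *\<^sub>R (R t ** Omega t)) (at t within arc_domain l)"
    using geodesic unfolding cuspless_geodesic_def Omega_def by blast
  then show "(x has_vector_derivative R t *v axis 3 1) (at t)"
    and "(R has_vector_derivative (1 / l t $ 3) *\<^sub>R (R t ** Omega t)) (at t)"
    by (auto dest: at_interior[OF s])
qed

lemma R_mult_deriv:
  assumes "s \<in> arc_domain l" "0 < t" "t < s" and "(g has_vector_derivative g') (at t)"
  shows "((\<lambda>t. R t *v g t) has_vector_derivative
    R t *v (g' + (1 / l t $ 3) *\<^sub>R (Omega t *v g t))) (at t)"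
  using bounded_bilinear.has_vector_derivative[OF bounded_bilinear_matrix_vector_mult
      derivatives(2)[OF assms(1-3)] assms(4)]
  by (simp add: matrix_vector_right_distrib matrix_vector_mult_scaleR matrix_vector_mul_assoc
      flip: scaleR_matrix_vector_assoc)

text \<open>The equations may be singular at the ends, so derivatives are available only inside;
  continuity carries constancy to the ends.\<close>

lemma constant_on_domain:
  fixes f :: "real \<Rightarrow> 'b::real_normed_vector"
  assumes s: "s \<in> arc_domain l" and cont: "continuous_on (arc_domain l) f"
    and deriv: "\<And>t. 0 < t \<Longrightarrow> t < s \<Longrightarrow> (f has_vector_derivative 0) (at t)"
  shows "f s = f 0"
proof -
  have "((\<lambda>_. 0) has_integral f s - f 0) {0..s}"
    using deriv continuous_on_subset[OF cont domain_segment[OF s]] domain_nonneg[OF s]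
    by (intro fundamental_theorem_of_calculus_interior) auto
  then show ?thesis
    using has_integral_0_eq by fastforce
qed

lemma continuous_R_mult:
  "continuous_on (arc_domain l) g \<Longrightarrow> continuous_on (arc_domain l) (\<lambda>t. R t *v g t)"
  using bounded_bilinear.continuous_on[OF bounded_bilinear_matrix_vector_mult continuous_R] .

lemma continuous_mu: "continuous_on S mu" and continuous_nu: "continuous_on S nu"
  unfolding mu_def[abs_def] nu_def[abs_def]
  by (intro continuous_vector_3 continuous_l continuous_on_const; simp)+

lemma nu_deriv: "(nu has_vector_derivative nu' t) (at t)"
  unfolding nu_def[abs_def] nu'_def
  by (intro vector_deriv_vector_3 l4_deriv l5_deriv) simp

lemma l3_deriv:
  assumes "0 < l t $ 3"
  shows "((\<lambda>s. l s $ 3) has_real_derivative (l t $ 1 * l t $ 5 - l t $ 2 * l t $ 4) / l t $ 3) (at t)"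
proof -
  have "0 < 1 - (l t $ 4)\<^sup>2 - (l t $ 5)\<^sup>2"
    using assms l3[of t] by simp
  moreover have "((\<lambda>s. 1 - (l s $ 4)\<^sup>2 - (l s $ 5)\<^sup>2) has_real_derivative
      2 * (l t $ 1 * l t $ 5 - l t $ 2 * l t $ 4)) (at t)"
    by (auto intro!: derivative_eq_intros l4_deriv l5_deriv simp: algebra_simps)
  ultimately have "((\<lambda>s. sqrt (1 - (l s $ 4)\<^sup>2 - (l s $ 5)\<^sup>2)) has_real_derivative
      inverse (sqrt (1 - (l t $ 4)\<^sup>2 - (l t $ 5)\<^sup>2)) / 2 * (2 * (l t $ 1 * l t $ 5 - l t $ 2 * l t $ 4))) (at t)"
    by (intro DERIV_chain2[OF DERIV_real_sqrt])
  moreover have "inverse a / 2 * (2 * b) = b / a" for a b :: real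
    by (simp add: field_simps)
  ultimately show ?thesis
    by (simp only: l3[symmetric])
qed

text \<open>The momentum equations read \<open>mu' = - (1 / \<lambda>\<^sub>3) Omega mu\<close>,
  which cancels the contribution of \<open>R'\<close>.\<close>

lemma R_mu: "s \<in> arc_domain l \<Longrightarrow> R s *v mu s = mu 0"
proof -
  assume s: "s \<in> arc_domain l"
  have "R s *v mu s = R 0 *v mu 0"
  proof (rule constant_on_domain[OF s])
    show "continuous_on (arc_domain l) (\<lambda>t. R t *v mu t)"
      by (intro continuous_R_mult continuous_mu)
  next
    fix t assume t: "0 < t" "t < s"
    have pos: "0 < l t $ 3"
      by (rule l3_pos[OF s t])
    define d where "d = (l t $ 1 * l t $ 5 - l t $ 2 * l t $ 4) / l t $ 3"
    have "(mu has_vector_derivative vector [- (l t $ 5), l t $ 4, d]) (at t)"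
      unfolding mu_def[abs_def] d_def by (intro vector_deriv_vector_3 l1_deriv l2_deriv l3_deriv pos)
    from R_mult_deriv[OF s t this]
    have "((\<lambda>t. R t *v mu t) has_vector_derivative
      R t *v (vector [- (l t $ 5), l t $ 4, d] + (1 / l t $ 3) *\<^sub>R (Omega t *v mu t))) (at t)" .
    also have "vector [- (l t $ 5), l t $ 4, d] + (1 / l t $ 3) *\<^sub>R (Omega t *v mu t) = 0"
      using pos by (simp add: vec_eq_iff forall_3 Omega_mult mu_def d_def field_simps)
    finally show "((\<lambda>t. R t *v mu t) has_vector_derivative 0) (at t)"
      by simp
  qed
  then show ?thesis by (simp add: R_0)
qed

lemma Omega_nu: "Omega t *v nu t = 0"
  by (simp add: vec_eq_iff forall_3 Omega_mult nu_def)

lemma R_nu_deriv: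
  assumes "s \<in> arc_domain l" "0 < t" "t < s"
  shows "((\<lambda>t. R t *v nu t) has_vector_derivative R t *v nu' t) (at t)"
  using R_mult_deriv[OF assms nu_deriv] by (simp add: Omega_nu)

text \<open>\<open>Omega nu = 0\<close> leaves \<open>R nu'\<close> as the derivative of
  \<open>R nu\<close>. By \<open>R_mu\<close> the other term has derivative
  \<open>R (e\<^sub>z \<times> mu)\<close>, and
  \<open>e\<^sub>z \<times> mu = - nu'\<close>.\<close>

lemma R_nu: "s \<in> arc_domain l \<Longrightarrow> R s *v nu s + cross3 (x s) (mu 0) = nu 0"
proof -
  assume s: "s \<in> arc_domain l"
  have lin: "bounded_linear (\<lambda>y. cross3 y (mu 0))"
    using bilinear_cross by (simp add: bilinear_def linear_conv_bounded_linear)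
  have "R s *v nu s + cross3 (x s) (mu 0) = R 0 *v nu 0 + cross3 (x 0) (mu 0)"
  proof (rule constant_on_domain[OF s])
    show "continuous_on (arc_domain l) (\<lambda>t. R t *v nu t + cross3 (x t) (mu 0))"
      by (intro continuous_intros continuous_R_mult continuous_nu
          bounded_linear.continuous_on[OF lin] continuous_x)
  next
    fix t assume t: "0 < t" "t < s"
    have t': "t \<in> arc_domain l"
      using domain_segment[OF s] t by auto
    have "((\<lambda>t. R t *v nu t + cross3 (x t) (mu 0)) has_vector_derivative
        R t *v nu' t + cross3 (R t *v axis 3 1) (mu 0)) (at t)"
      by (intro has_vector_derivative_add R_nu_deriv[OF s t]
          bounded_linear.has_vector_derivative[OF lin] derivatives(1)[OF s t])
    also have "cross3 (R t *v axis 3 1) (mu 0) = R t *v cross3 (axis 3 1) (mu t)"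
      by (simp flip: R_mu[OF t'] add: cross_rotation_matrix[OF rotation_R[OF t']])
    also have "cross3 (axis 3 1) (mu t) = - nu' t"
      by (simp add: vec_eq_iff forall_3 cross3_components mu_def nu'_def axis_def)
    finally show "((\<lambda>t. R t *v nu t + cross3 (x t) (mu 0)) has_vector_derivative 0) (at t)"
      by (simp add: linear_neg[OF matrix_vector_mul_linear])
  qed
  then show ?thesis
    by (simp add: R_0 x_0 cross_zero_left)
qed

text \<open>\<open>x' = R e\<^sub>z\<close> and \<open>mu 0 = R mu\<close>, so the inner product of
  \<open>x'\<close> with \<open>mu 0\<close> is the third component of \<open>mu\<close>.\<close>

lemma x_mu:
  assumes s: "s \<in> arc_domain l"
  shows "x s \<bullet> mu 0 = integral {0..s} (\<lambda>\<tau>. l \<tau> $ 3)"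
proof -
  have "((\<lambda>\<tau>. l \<tau> $ 3) has_integral x s \<bullet> mu 0 - x 0 \<bullet> mu 0) {0..s}"
  proof (rule fundamental_theorem_of_calculus_interior)
    show "continuous_on {0..s} (\<lambda>t. x t \<bullet> mu 0)"
      by (intro continuous_intros continuous_on_subset[OF continuous_x domain_segment[OF s]])
  next
    fix t assume t: "t \<in> {0<..<s}"
    then have t': "t \<in> arc_domain l"
      using domain_segment[OF s] by auto
    have "((\<lambda>t. x t \<bullet> mu 0) has_vector_derivative (R t *v axis 3 1) \<bullet> mu 0) (at t)"
      using t by (intro bounded_linear.has_vector_derivative[OF bounded_linear_inner_left]
          derivatives(1)[OF s]) auto
    also have "(R t *v axis 3 1) \<bullet> mu 0 = l t $ 3"
      using rotation_R[OF t']
      by (simp flip: R_mu[OF t'] add: orthogonal_matrix_inner rotation_matrix_def)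
        (simp add: inner_vector_3 axis_def mu_def)
    finally show "((\<lambda>t. x t \<bullet> mu 0) has_vector_derivative l t $ 3) (at t)" .
  qed (rule domain_nonneg[OF s])
  then show ?thesis
    by (simp add: x_0 integral_unique)
qed

text \<open>The left side is \<open>mu t \<bullet> nu t\<close>; its constancy confines
  \<open>R nu\<close> to a plane orthogonal to \<open>mu 0\<close>.\<close>

lemma W_const_t: "l t $ 1 * l t $ 4 + l t $ 2 * l t $ 5 = - \<W>"
proof -
  have "l t $ 1 * l t $ 4 + l t $ 2 * l t $ 5 =
      ((cosh t)\<^sup>2 - (sinh t)\<^sup>2) * (l 0 $ 1 * l 0 $ 4 + l 0 $ 2 * l 0 $ 5)"
    unfolding l1[of t] l2[of t] l4[of t] l5[of t] by (simp add: algebra_simps power2_eq_square)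
  then show ?thesis
    by (simp add: W_const_def cosh_square_eq)
qed

text \<open>For \<open>W = 0\<close> all \<open>\<nu>(t)\<close> are parallel to one line, and so is the angular velocity of \<open>R\<close>.\<close>

lemma R_nu_W_zero:
  assumes "\<W> = 0" and s: "s \<in> arc_domain l"
  shows "R s *v nu s = nu s"
proof -
  have wronskian: "l t $ 4 * l s $ 5 - l t $ 5 * l s $ 4 = 0" for t
  proof -
    have "l t $ 4 * l s $ 5 - l t $ 5 * l s $ 4 =
        - \<W> * (sinh t * cosh s - cosh t * sinh s)"
      unfolding l4[of t] l5[of t] l4[of s] l5[of s] W_const_def by (simp add: algebra_simps)
    then show ?thesis using \<open>\<W> = 0\<close> by simp
  qed
  \<comment> \<open>The vector \<open>nu s\<close> stays fixed while \<open>t\<close> runs; being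
    parallel to the axis of rotation at every time, it is not moved by \<open>R t\<close>.\<close>
  have "R s *v nu s = R 0 *v nu s"
  proof (rule constant_on_domain[OF s])
    show "continuous_on (arc_domain l) (\<lambda>t. R t *v nu s)"
      by (intro continuous_R_mult continuous_on_const)
    fix t assume "0 < t" "t < s"
    from R_mult_deriv[OF s this, of "\<lambda>_. nu s" 0]
    have "((\<lambda>t. R t *v nu s) has_vector_derivative
        R t *v (0 + (1 / l t $ 3) *\<^sub>R (Omega t *v nu s))) (at t)"
      by simp
    also have "Omega t *v nu s = 0"
      using wronskian[of t] by (simp add: vec_eq_iff forall_3 Omega_mult nu_def)
    finally show "((\<lambda>t. R t *v nu s) has_vector_derivative 0) (at t)"
      by simp
  qed
  then show ?thesis by (simp add: R_0)
qed

section \<open>The frame adapted to the linear momentum\<close>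

lemma R_tilde_mult:
  assumes "lam1 l 0 \<noteq> 0"
  defines "n \<equiv> norm (lam1 l 0)"
  shows "(R_tilde l *v v) $ 1 = (l 0 $ 1 * v $ 1 + l 0 $ 2 * v $ 2 + l 0 $ 3 * v $ 3) / \<c>"
    and "(R_tilde l *v v) $ 2 = (l 0 $ 1 * v $ 2 - l 0 $ 2 * v $ 1) / n"
    and "(R_tilde l *v v) $ 3 =
      (n\<^sup>2 * v $ 3 - l 0 $ 3 * (l 0 $ 1 * v $ 1 + l 0 $ 2 * v $ 2)) / (\<c> * n)"
proof -
  have n: "n > 0" using assms by (simp add: n_def)
  show "(R_tilde l *v v) $ 1 = (l 0 $ 1 * v $ 1 + l 0 $ 2 * v $ 2 + l 0 $ 3 * v $ 3) / \<c>"
    "(R_tilde l *v v) $ 2 = (l 0 $ 1 * v $ 2 - l 0 $ 2 * v $ 1) / n"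
    "(R_tilde l *v v) $ 3 =
      (n\<^sup>2 * v $ 3 - l 0 $ 3 * (l 0 $ 1 * v $ 1 + l 0 $ 2 * v $ 2)) / (\<c> * n)"
    using assms(1) n c_pos
    by (simp_all add: R_tilde_def Let_def matrix_vector_mult_def sum_3 add_divide_distrib
        diff_divide_distrib distrib_left power2_eq_square mult.commute mult.left_commute flip: n_def)
qed

text \<open>If \<open>lam1 l 0\<close> is nonzero, the rows are \<open>mu 0 / c\<close>, a
  horizontal unit vector orthogonal to it, and their cross product. The entries are polynomials in
  two unit vectors \<open>(a, b)\<close> and \<open>(S, T)\<close>, the azimuth and the inclination
  of \<open>mu 0\<close>.\<close>

lemma rotation_R_tilde: "rotation_matrix (R_tilde l)"
proof (cases "lam1 l 0 = 0")
  case True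
  then show ?thesis
    by (simp add: R_tilde_def rotation_matrix_def orthogonal_matrix det_3 vec_eq_iff forall_3
        matrix_matrix_mult_def sum_3 transpose_def mat_def)
next
  case False
  define n where "n = norm (lam1 l 0)"
  have n: "n > 0" "n\<^sup>2 = (l 0 $ 1)\<^sup>2 + (l 0 $ 2)\<^sup>2"
    using False norm_lam1[of 0] by (simp_all add: n_def)
  define a b S T where "a = l 0 $ 1 / n" and "b = l 0 $ 2 / n" and "S = n / \<c>" and "T = l 0 $ 3 / \<c>"
  have unit: "p / m * (p / m) + q / m * (q / m) = 1" if "m\<^sup>2 = p\<^sup>2 + q\<^sup>2" "0 < m" for m p q :: real
  proof -
    have "p / m * (p / m) + q / m * (q / m) = (p\<^sup>2 + q\<^sup>2) / m\<^sup>2"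
      by (simp add: power2_eq_square add_divide_distrib)
    also have "\<dots> = 1"
      using that by (simp flip: that(1))
    finally show ?thesis .
  qed
  have ab: "a * a + b * b = 1"
    unfolding a_def b_def by (rule unit) (use n in auto)
  have ST: "S * S + T * T = 1"
    unfolding S_def T_def by (rule unit) (use n c_sq c_pos in auto)
  define Q :: "real^3^3" where
    "Q = vector [vector [a * S, b * S, T], vector [- b, a, 0], vector [- (a * T), - (b * T), S]]"
  have "R_tilde l = Q"
    using False n(1) c_pos
    by (simp add: R_tilde_def Q_def Let_def vec_eq_iff forall_3 a_def b_def S_def T_def flip: n_def)
  moreover have "Q ** transpose Q = mat 1"
  proof -
    have "a * S * (a * S) + b * S * (b * S) + T * T = 1"
      "a * T * (a * T) + b * T * (b * T) + S * S = 1"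
      "T * S = a * S * (a * T) + b * S * (b * T)"
      using ab ST by algebra+
    with ab show ?thesis
      by (simp add: Q_def vec_eq_iff forall_3 matrix_matrix_mult_def sum_3 transpose_def mat_def
          algebra_simps)
  qed
  moreover have "det Q = 1"
  proof -
    have "det Q = a * S * (a * S) + b * S * (b * S) + (a * a * (T * T) + b * b * (T * T))"
      by (simp add: Q_def det_3 algebra_simps)
    also have "\<dots> = 1"
      using ab ST by algebra
    finally show ?thesis .
  qed
  ultimately show ?thesis
    using matrix_left_right_inverse[of Q "transpose Q"]
    by (simp add: rotation_matrix_def orthogonal_matrix_def)
qed

text \<open>The cross product with \<open>mu 0\<close> acts on the plane orthogonal to
  \<open>mu 0\<close> as a quarter turn scaled by \<open>c\<close>. Solving \<open>R_nu\<close> for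
  \<open>x\<close> in the adapted frame therefore swaps the last two coordinates, up to sign, and
  divides by \<open>c\<close>.\<close>

lemma yz_from_R_nu:
  assumes "lam1 l 0 \<noteq> 0" and s: "s \<in> arc_domain l"
  shows "(R_tilde l *v x s) $ 2 = ((R_tilde l *v (R s *v nu s)) $ 3 - (R_tilde l *v nu 0) $ 3) / \<c>"
    and "(R_tilde l *v x s) $ 3 = ((R_tilde l *v nu 0) $ 2 - (R_tilde l *v (R s *v nu s)) $ 2) / \<c>"
proof -
  define n where "n = norm (lam1 l 0)"
  have n: "n > 0" "n\<^sup>2 = (l 0 $ 1)\<^sup>2 + (l 0 $ 2)\<^sup>2"
    using assms(1) norm_lam1[of 0] by (simp_all add: n_def)
  have c: "\<c>\<^sup>2 = n\<^sup>2 + (l 0 $ 3)\<^sup>2"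
    using c_sq n by simp
  define e where "e = R s *v nu s"
  have "e = nu 0 - cross3 (x s) (mu 0)"
    using R_nu[OF s] by (simp only: e_def eq_diff_eq)
  then have e: "e $ 1 = nu 0 $ 1 - (x s $ 2 * l 0 $ 3 - x s $ 3 * l 0 $ 2)"
    "e $ 2 = nu 0 $ 2 - (x s $ 3 * l 0 $ 1 - x s $ 1 * l 0 $ 3)"
    "e $ 3 = nu 0 $ 3 - (x s $ 1 * l 0 $ 2 - x s $ 2 * l 0 $ 1)"
    by (simp_all add: cross3_components mu_def)
  have "n\<^sup>2 * e $ 3 - l 0 $ 3 * (l 0 $ 1 * e $ 1 + l 0 $ 2 * e $ 2) -
      (n\<^sup>2 * nu 0 $ 3 - l 0 $ 3 * (l 0 $ 1 * nu 0 $ 1 + l 0 $ 2 * nu 0 $ 2)) =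
      \<c>\<^sup>2 * (l 0 $ 1 * x s $ 2 - l 0 $ 2 * x s $ 1)"
    unfolding e c by (simp add: algebra_simps power2_eq_square)
  then show "(R_tilde l *v x s) $ 2 =
      ((R_tilde l *v (R s *v nu s)) $ 3 - (R_tilde l *v nu 0) $ 3) / \<c>"
    unfolding R_tilde_mult[OF assms(1), folded n_def] e_def[symmetric]
    using c_pos n(1) by (simp only: diff_divide_distrib[symmetric]) (simp add: power2_eq_square)
  have "(l 0 $ 1 * nu 0 $ 2 - l 0 $ 2 * nu 0 $ 1) - (l 0 $ 1 * e $ 2 - l 0 $ 2 * e $ 1) =
      n\<^sup>2 * x s $ 3 - l 0 $ 3 * (l 0 $ 1 * x s $ 1 + l 0 $ 2 * x s $ 2)"
    unfolding e n(2) by (simp add: algebra_simps power2_eq_square)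
  then show "(R_tilde l *v x s) $ 3 =
      ((R_tilde l *v nu 0) $ 2 - (R_tilde l *v (R s *v nu s)) $ 2) / \<c>"
    unfolding R_tilde_mult[OF assms(1), folded n_def] e_def[symmetric]
    by (simp only: diff_divide_distrib[symmetric] divide_divide_eq_left mult.commute[of n])
qed

section \<open>Motion orthogonal to the linear momentum\<close>

lemma yz_tilde_eq_W_zero:
  assumes "lam1 l 0 \<noteq> 0" "\<W> = 0" and s: "s \<in> arc_domain l"
  shows "yz_tilde l s $ 1 = (R_tilde l *v (R s *v nu s)) $ 3 / \<c>"
    and "yz_tilde l s $ 2 = - (R_tilde l *v (R s *v nu s)) $ 2 / \<c>"
proof -
  \<comment> \<open>This is \<open>mu 0 \<bullet> nu s\<close>; for \<open>W = 0\<close> it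
    vanishes, and with it the first planar coordinate.\<close>
  have "l 0 $ 1 * l s $ 4 + l 0 $ 2 * l s $ 5 = - \<W> * cosh s"
    unfolding l4[of s] l5[of s] W_const_def by (simp add: algebra_simps)
  then show "yz_tilde l s $ 1 = (R_tilde l *v (R s *v nu s)) $ 3 / \<c>"
    unfolding R_nu_W_zero[OF assms(2,3)] R_tilde_mult[OF assms(1)]
    using assms by (simp add: yz_tilde_def Let_def nu_def)
  have "lam2 l s \<bullet> lam1 l 0 = - (l 0 $ 1 * l s $ 5 - l 0 $ 2 * l s $ 4)"
    by (simp add: lam1_def lam2_def inner_vec_def sum_2)
  then show "yz_tilde l s $ 2 = - (R_tilde l *v (R s *v nu s)) $ 2 / \<c>"
    unfolding R_nu_W_zero[OF assms(2,3)] R_tilde_mult[OF assms(1)]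
    using assms
    by (simp add: yz_tilde_def Let_def nu_def mult.commute minus_divide_left del: divide_minus_left)
qed

text \<open>\<open>W\<close> is the determinant of \<open>lam2 l 0\<close> and
  \<open>lam1 l 0\<close>, so the two vectors are linearly independent.\<close>

lemma generic_if_W_nonzero:
  assumes "\<W> \<noteq> 0"
  shows "generic_momentum_curve l"
proof
  have "\<W> = 0" if "lam1 l 0 = lam2 l 0 \<or> lam1 l 0 = - lam2 l 0"
  proof -
    have "l 0 $ 5 = - (l 0 $ 1) \<and> l 0 $ 4 = l 0 $ 2 \<or> l 0 $ 5 = l 0 $ 1 \<and> l 0 $ 4 = - (l 0 $ 2)"
      using that by (auto simp: lam1_def lam2_def vec_eq_iff forall_2)
    then show ?thesis
      by (auto simp: W_const_def)
  qed
  with assms show "lam1 l 0 \<noteq> lam2 l 0" "lam1 l 0 \<noteq> - lam2 l 0"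
    by blast+
qed

text \<open>In the adapted frame the first coordinate of \<open>R nu\<close> is the constant
  \<open>- W / c\<close>, so the other two trace a planar curve. Preservation of lengths gives its
  squared radius \<open>N\<close>, and the triple product
  \<open>mu \<bullet> (nu \<times> nu') = W \<lambda>\<^sub>3\<close> its angular velocity
  \<open>\<beta>\<close>.\<close>

lemma yz_tilde_eq_W_nonzero:
  assumes lam1: "lam1 l 0 \<noteq> 0" and W: "\<W> \<noteq> 0" and s: "s \<in> arc_domain l"
  shows "yz_tilde l s $ 1 = (R_tilde l *v (R s *v nu s)) $ 3 / \<c>"
    and "yz_tilde l s $ 2 = - (R_tilde l *v (R s *v nu s)) $ 2 / \<c>"
proof -
  interpret generic_momentum_curve l
    by (rule generic_if_W_nonzero[OF W])
  define n where "n = norm (lam1 l 0)"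
  define N where "N t = (norm (lam2 l t))\<^sup>2 - \<W>\<^sup>2 / \<c>\<^sup>2" for t
  define E where "E t = R_tilde l *v (R t *v nu t)" for t
  define E' where "E' t = R_tilde l *v (R t *v nu' t)" for t
  \<comment> \<open>\<open>\<alpha>\<close> is the logarithmic derivative of the radius
    \<open>sqrt N\<close>, and \<open>\<beta>\<close> is the derivative of
    \<open>psi_tilde\<close>.\<close>
  define \<alpha> where "\<alpha> t = nu t \<bullet> nu' t / N t" for t
  define \<beta> where "\<beta> t = \<W> / \<c> * l t $ 3 / N t" for t
  have N_pos: "0 < N t" for t
    using denom_pos[OF W] by (simp add: N_def norm_lam2_minus)
  have N_eq: "N = (\<lambda>t. (l t $ 4)\<^sup>2 + (l t $ 5)\<^sup>2 - \<W>\<^sup>2 / \<c>\<^sup>2)"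
    by (rule ext) (simp add: N_def norm_lam2)
  have cont_N: "continuous_on S N" for S
    unfolding N_eq by (intro continuous_intros continuous_l) auto
  have cont_\<beta>: "continuous_on S \<beta>" for S
    unfolding \<beta>_def[abs_def] using N_pos[THEN less_imp_neq]
    by (intro continuous_on_divide continuous_on_mult continuous_on_const continuous_l cont_N)
      (auto dest: sym)
  have orth: "orthogonal_matrix (R_tilde l)"
    using rotation_R_tilde by (simp add: rotation_matrix_def)
  \<comment> \<open>The first row of \<open>R_tilde l\<close> is \<open>mu 0 / c\<close>, and
    \<open>R_mu\<close> lets \<open>R t\<close> drop out of the inner product.\<close>
  have E1: "(R_tilde l *v (R t *v v)) $ 1 = mu t \<bullet> v / \<c>" if "t \<in> arc_domain l" for t v
  proof -
    have "(R_tilde l *v (R t *v v)) $ 1 = mu 0 \<bullet> (R t *v v) / \<c>"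
      unfolding R_tilde_mult[OF lam1] by (simp add: inner_vector_3 mu_def)
    also have "\<dots> = mu t \<bullet> v / \<c>"
      using rotation_R[OF that] orthogonal_matrix_inner[of "R t" "mu t" v]
      by (simp add: R_mu[OF that] rotation_matrix_def)
    finally show ?thesis .
  qed
  have cont_E: "continuous_on {0..s} (\<lambda>t. E t $ i)" for i
    unfolding E_def
    by (intro continuous_intros continuous_on_subset[OF continuous_R_mult[OF continuous_nu] domain_segment[OF s]]
        bounded_linear.continuous_on[OF matrix_vector_mul_bounded_linear])
  have deriv_E: "((\<lambda>t. E t $ i) has_real_derivative E' t $ i) (at t)" if t: "0 < t" "t < s" for t i
    unfolding E_def E'_def has_real_derivative_iff_has_vector_derivative
    by (intro bounded_linear.has_vector_derivative[OF bounded_linear_vec_nth]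
        bounded_linear.has_vector_derivative[OF matrix_vector_mul_bounded_linear] R_nu_deriv[OF s t])
  have E_products: "(E t $ 2)\<^sup>2 + (E t $ 3)\<^sup>2 = N t"
    "E t $ 2 * E' t $ 2 + E t $ 3 * E' t $ 3 = \<alpha> t * N t"
    "E t $ 2 * E' t $ 3 - E t $ 3 * E' t $ 2 = \<beta> t * N t"
    if t: "t \<in> arc_domain l" for t
  proof -
    have rot: "orthogonal_matrix (R t)"
      using rotation_R[OF t] by (simp add: rotation_matrix_def)
    have "mu t \<bullet> nu t = - \<W>"
      using W_const_t[of t] by (simp add: inner_vector_3 mu_def nu_def)
    then have "E t $ 1 = - \<W> / \<c>"
      by (simp add: E_def E1[OF t])
    moreover have "E t \<bullet> E t = (norm (lam2 l t))\<^sup>2"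
      by (simp add: E_def orthogonal_matrix_inner[OF orth] orthogonal_matrix_inner[OF rot] norm_lam2)
        (simp add: inner_vector_3 nu_def power2_eq_square)
    ultimately show "(E t $ 2)\<^sup>2 + (E t $ 3)\<^sup>2 = N t"
      by (simp add: inner_vector_3 N_def power2_eq_square)
    have "mu t \<bullet> nu' t = 0"
      by (simp add: inner_vector_3 mu_def nu'_def)
    then have "E' t $ 1 = 0"
      by (simp add: E'_def E1[OF t])
    moreover have "E t \<bullet> E' t = nu t \<bullet> nu' t"
      by (simp add: E_def E'_def orthogonal_matrix_inner[OF orth] orthogonal_matrix_inner[OF rot])
    ultimately show "E t $ 2 * E' t $ 2 + E t $ 3 * E' t $ 3 = \<alpha> t * N t"
      using N_pos[of t] by (simp add: inner_vector_3[of "E t"] \<alpha>_def)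
    have "cross3 (E t) (E' t) = R_tilde l *v (R t *v cross3 (nu t) (nu' t))"
      by (simp add: E_def E'_def cross_rotation_matrix rotation_R_tilde rotation_R[OF t])
    then have "cross3 (E t) (E' t) $ 1 = mu t \<bullet> cross3 (nu t) (nu' t) / \<c>"
      by (simp add: E1[OF t])
    also have "mu t \<bullet> cross3 (nu t) (nu' t) =
        - (l t $ 1 * l t $ 4 + l t $ 2 * l t $ 5) * l t $ 3"
      by (simp add: inner_vector_3 cross3_components mu_def nu_def nu'_def algebra_simps)
    finally show "E t $ 2 * E' t $ 3 - E t $ 3 * E' t $ 2 = \<beta> t * N t"
      using N_pos[of t] by (simp add: cross3_components W_const_t \<beta>_def)
  qed
  have psi: "psi_tilde l = (\<lambda>t. integral {0..t} \<beta>)"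
    by (rule ext) (simp add: psi_tilde_def \<beta>_def[abs_def] N_def)
  \<comment> \<open>The coordinates \<open>E 3\<close> and \<open>- E 2\<close> anticipate the
    quarter turn in \<open>yz_from_R_nu\<close>.\<close>
  have polar: "E s $ 3 = sqrt (N s) / sqrt (N 0) *
      (cos (psi_tilde l s) * E 0 $ 3 - sin (psi_tilde l s) * - E 0 $ 2) \<and>
      - E s $ 2 = sqrt (N s) / sqrt (N 0) *
      (sin (psi_tilde l s) * E 0 $ 3 + cos (psi_tilde l s) * - E 0 $ 2)"
  proof (rule scaled_rotation_unique[where Y = "\<lambda>t. E t $ 3" and Z = "\<lambda>t. - E t $ 2" and a = 0
        and b = s and \<psi> = "psi_tilde l" and r = "\<lambda>t. sqrt (N t)" and \<alpha> = \<alpha> and \<beta> = \<beta>])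
    show "continuous_on {0..s} (psi_tilde l)"
      unfolding psi
      by (intro indefinite_integral_continuous_1 integrable_continuous_real cont_\<beta>)
    show "continuous_on {0..s} (\<lambda>t. E t $ 3)" "continuous_on {0..s} (\<lambda>t. - E t $ 2)"
      "continuous_on {0..s} (\<lambda>t. sqrt (N t))"
      by (intro continuous_intros cont_E cont_N)+
    show "psi_tilde l 0 = 0"
      by (simp add: psi)
    fix t assume t: "0 < t" "t < s"
    then have t': "t \<in> arc_domain l"
      using domain_segment[OF s] by auto
    note E = E_products[OF t']
    \<comment> \<open>A planar vector is recovered from its inner and its cross product with
      \<open>E\<close>, after division by the squared radius \<open>N t > 0\<close>.\<close>
    have "E' t $ 3 * N t = E t $ 3 * (E t $ 2 * E' t $ 2 + E t $ 3 * E' t $ 3) +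
        E t $ 2 * (E t $ 2 * E' t $ 3 - E t $ 3 * E' t $ 2)"
      unfolding E(1)[symmetric] by (simp add: power2_eq_square algebra_simps)
    also have "\<dots> = (\<alpha> t * E t $ 3 - \<beta> t * - E t $ 2) * N t"
      unfolding E(2,3) by (simp add: algebra_simps)
    finally have "E' t $ 3 = \<alpha> t * E t $ 3 - \<beta> t * - E t $ 2"
      using N_pos[of t] by simp
    then show "((\<lambda>t. E t $ 3) has_real_derivative \<alpha> t * E t $ 3 - \<beta> t * - E t $ 2) (at t)"
      using deriv_E[OF t, of 3] by simp
    have "- E' t $ 2 * N t = E t $ 3 * (E t $ 2 * E' t $ 3 - E t $ 3 * E' t $ 2) -
        E t $ 2 * (E t $ 2 * E' t $ 2 + E t $ 3 * E' t $ 3)"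
      unfolding E(1)[symmetric] by (simp add: power2_eq_square algebra_simps)
    also have "\<dots> = (\<alpha> t * - E t $ 2 + \<beta> t * E t $ 3) * N t"
      unfolding E(2,3) by (simp add: algebra_simps)
    finally have "- E' t $ 2 = \<alpha> t * - E t $ 2 + \<beta> t * E t $ 3"
      using N_pos[of t] by (simp only: mult_cancel_right) simp
    then show "((\<lambda>t. - E t $ 2) has_real_derivative \<alpha> t * - E t $ 2 + \<beta> t * E t $ 3) (at t)"
      using DERIV_minus[OF deriv_E[OF t, of 2]] by simp
    have "(psi_tilde l has_real_derivative \<beta> t) (at t within {0..s})"
      unfolding psi using t by (intro integral_has_real_derivative cont_\<beta>) auto
    then show "(psi_tilde l has_real_derivative \<beta> t) (at t)"
      using t by (simp add: at_within_Icc_at)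
    have "(N has_real_derivative 2 * (nu t \<bullet> nu' t)) (at t)"
      unfolding N_eq
      by (auto intro!: derivative_eq_intros l4_deriv l5_deriv simp: inner_vector_3 nu_def nu'_def algebra_simps)
    from DERIV_chain2[OF DERIV_real_sqrt[OF N_pos] this]
    have "((\<lambda>t. sqrt (N t)) has_real_derivative
        inverse (sqrt (N t)) / 2 * (2 * (nu t \<bullet> nu' t))) (at t)" .
    also have "inverse (sqrt (N t)) / 2 * (2 * (nu t \<bullet> nu' t)) = nu t \<bullet> nu' t / sqrt (N t)"
      by (simp add: field_simps)
    also have "\<dots> = \<alpha> t * sqrt (N t)"
      using N_pos[of t] by (simp add: \<alpha>_def real_div_sqrt field_simps)
    finally show "((\<lambda>t. sqrt (N t)) has_real_derivative \<alpha> t * sqrt (N t)) (at t)" .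
  qed (use N_pos domain_nonneg[OF s] in auto)
  have n: "n > 0"
    using lam1 by (simp add: n_def)
  have E0: "E 0 $ 3 = \<W> * l 0 $ 3 / (\<c> * n)" "- E 0 $ 2 = (lam2 l 0 \<bullet> lam1 l 0) / n"
  proof -
    have "E 0 $ 3 = - (l 0 $ 3 * (l 0 $ 1 * l 0 $ 4 + l 0 $ 2 * l 0 $ 5)) / (\<c> * n)"
      unfolding E_def R_0 matrix_vector_mul_lid R_tilde_mult[OF lam1, folded n_def]
      by (simp add: nu_def)
    then show "E 0 $ 3 = \<W> * l 0 $ 3 / (\<c> * n)"
      by (simp add: W_const_t mult.commute)
    show "- E 0 $ 2 = (lam2 l 0 \<bullet> lam1 l 0) / n"
      unfolding E_def R_0 matrix_vector_mul_lid R_tilde_mult[OF lam1, folded n_def]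
      by (simp add: nu_def lam1_def lam2_def inner_vec_def sum_2 mult.commute minus_divide_left
          del: divide_minus_left)
  qed
  have yz: "yz_tilde l s $ 1 = sqrt (N s) / (\<c>\<^sup>2 * n * sqrt (N 0)) *
      (cos (psi_tilde l s) * (\<W> * l 0 $ 3) - sin (psi_tilde l s) * (\<c> * (lam2 l 0 \<bullet> lam1 l 0)))"
    "yz_tilde l s $ 2 = sqrt (N s) / (\<c>\<^sup>2 * n * sqrt (N 0)) *
      (sin (psi_tilde l s) * (\<W> * l 0 $ 3) + cos (psi_tilde l s) * (\<c> * (lam2 l 0 \<bullet> lam1 l 0)))"
    using lam1 W
    by (simp_all add: yz_tilde_def Let_def matrix_vector_mult_def sum_2 flip: n_def N_def)
  have scale: "sqrt (N s) / (\<c>\<^sup>2 * n * sqrt (N 0)) * (a * p + b * (\<c> * q)) =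
      sqrt (N s) / sqrt (N 0) * (a * (p / (\<c> * n)) + b * (q / n)) / \<c>" for a b p q
    using c_pos n N_pos[of 0] by (simp add: field_simps power2_eq_square)
  show "yz_tilde l s $ 1 = (R_tilde l *v (R s *v nu s)) $ 3 / \<c>"
    using scale[of "cos (psi_tilde l s)" _ "- sin (psi_tilde l s)"]
    unfolding yz E_def[symmetric] polar[THEN conjunct1] E0 by simp
  have "- (R_tilde l *v (R s *v nu s)) $ 2 / \<c> = - E s $ 2 / \<c>"
    by (simp add: E_def)
  then show "yz_tilde l s $ 2 = - (R_tilde l *v (R s *v nu s)) $ 2 / \<c>"
    unfolding yz polar[THEN conjunct2] E0 by (simp only: scale)
qed

section \<open>Reconstruction of the spatial curve\<close>

lemma spatial_part:
  assumes s: "s \<in> arc_domain l"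
  shows "x s = transpose (R_tilde l) *v (curve_tilde l s - curve_tilde l 0)"
proof -
  have x1: "x_tilde l s = x s \<bullet> mu 0 / \<c>" "x_tilde l 0 = 0"
    by (simp_all add: x_tilde_def x_mu[OF s])
  have "R_tilde l *v x s = curve_tilde l s - curve_tilde l 0"
  proof (cases "lam1 l 0 = 0")
    \<comment> \<open>Here \<open>mu 0\<close> is \<open>c\<close> times the vertical unit vector
      and \<open>W = 0\<close>, so \<open>R_nu\<close> solves directly for the horizontal
      coordinates.\<close>
    case True
    then have l0: "l 0 $ 1 = 0" "l 0 $ 2 = 0"
      by (auto simp: lam1_def vec_eq_iff forall_2)
    then have "\<W> = 0"
      by (simp add: W_const_def)
    have c: "\<c> = l 0 $ 3"
      using c_sq c_pos l3_nonneg[OF zero_in_domain] by (simp add: l0)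
    have "nu s + cross3 (x s) (mu 0) = nu 0"
      using R_nu[OF s] R_nu_W_zero[OF \<open>\<W> = 0\<close> s] by simp
    then have "l s $ 4 + x s $ 2 * \<c> = l 0 $ 4" "l s $ 5 - x s $ 1 * \<c> = l 0 $ 5"
      by (simp_all add: vec_eq_iff forall_3 cross3_components nu_def mu_def l0 c)
    then have "x s $ 2 = (l 0 $ 4 - l s $ 4) / \<c>" "x s $ 1 = (l s $ 5 - l 0 $ 5) / \<c>"
      using c_pos by (simp_all add: field_simps)
    moreover have "x_tilde l s = x s $ 3"
      using c_pos by (simp add: x1 inner_vector_3 mu_def l0 c)
    ultimately show ?thesis
      using True x1 c_pos
      by (simp add: vec_eq_iff forall_3 curve_tilde_def yz_tilde_def R_tilde_def
          matrix_vector_mult_def sum_3 diff_divide_distrib)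
  next
    case False
    \<comment> \<open>Needed at \<open>s\<close> and at 0: since \<open>R 0\<close> is the identity,
      the value at 0 supplies the \<open>nu 0\<close> terms of \<open>yz_from_R_nu\<close>.\<close>
    have yz: "yz_tilde l t $ 1 = (R_tilde l *v (R t *v nu t)) $ 3 / \<c>"
      "yz_tilde l t $ 2 = - (R_tilde l *v (R t *v nu t)) $ 2 / \<c>" if "t \<in> arc_domain l" for t
      using yz_tilde_eq_W_zero[OF False _ that] yz_tilde_eq_W_nonzero[OF False _ that] by blast+
    have "(R_tilde l *v x s) $ 1 = x_tilde l s"
      unfolding R_tilde_mult[OF False] x1 by (simp add: inner_vector_3 mu_def mult.commute)
    then show ?thesis
      using yz_from_R_nu[OF False s] x1 yz[OF s] yz[OF zero_in_domain]
      by (simp add: vec_eq_iff forall_3 curve_tilde_def R_0 diff_divide_distrib)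
  qed
  then have "transpose (R_tilde l) *v (curve_tilde l s - curve_tilde l 0) =
      (transpose (R_tilde l) ** R_tilde l) *v x s"
    by (simp only: matrix_vector_mul_assoc[symmetric])
  then show ?thesis
    using rotation_R_tilde by (simp add: rotation_matrix_def orthogonal_matrix_def)
qed

end

theorem theorem6:
  fixes l :: "real \<Rightarrow> real^6" and x :: "real \<Rightarrow> real^3" and R :: "real \<Rightarrow> real^3^3"
  assumes l1: "\<forall>s. l s $ 1 = (l 0 $ 1) * cosh s - (l 0 $ 5) * sinh s"
    and l5: "\<forall>s. l s $ 5 = (l 0 $ 5) * cosh s - (l 0 $ 1) * sinh s"
    and l2: "\<forall>s. l s $ 2 = (l 0 $ 2) * cosh s + (l 0 $ 4) * sinh s"
    and l4: "\<forall>s. l s $ 4 = (l 0 $ 4) * cosh s + (l 0 $ 2) * sinh s"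
    and l3: "\<forall>s. l s $ 3 = sqrt (1 - \<bar>l s $ 4\<bar>\<^sup>2 - \<bar>l s $ 5\<bar>\<^sup>2)"
    and l6: "\<forall>s. l s $ 6 = 0"
    and nonzero: "(l 0 $ 1)\<^sup>2 + (l 0 $ 2)\<^sup>2 + (l 0 $ 3)\<^sup>2 \<noteq> 0"
    and normalized: "\<forall>s\<in>arc_domain l. (l s $ 3)\<^sup>2 + (l s $ 4)\<^sup>2 + (l s $ 5)\<^sup>2 = 1"
    and start: "l 0 $ 3 \<ge> 0"
    and geodesic: "cuspless_geodesic l x R"
  shows "rotation_matrix (R_tilde l) \<and>
    (\<forall>s\<in>arc_domain l. x s = transpose (R_tilde l) *v (curve_tilde l s - curve_tilde l 0)) \<and>
    (lam1 l 0 \<noteq> lam2 l 0 \<longrightarrow> d_const l \<le> 1) \<and>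
    (lam1 l 0 \<noteq> lam2 l 0 \<and> lam1 l 0 \<noteq> - lam2 l 0 \<longrightarrow>
      (let c = c_const l; d = d_const l; \<phi> = phi_const l; M = complex_of_real (M_const l) in
       \<forall>s\<in>arc_domain l.
         complex_of_real (x_tilde l s) =
           - (\<i> * complex_of_real (sqrt (1 - d) * sqrt (1 + c\<^sup>2) / (c * sqrt 2))) *
             (elliptic_E (complex_of_real (s + \<phi> / 2) * \<i>) M -
              elliptic_E (complex_of_real (\<phi> / 2) * \<i>) M))) \<and>
    (W_const l \<noteq> 0 \<and> lam1 l 0 \<noteq> 0 \<longrightarrow>
      (let c = c_const l; W = W_const l; d = d_const l; \<phi> = phi_const l;
           M = complex_of_real (M_const l); D = complex_of_real (D_const l) in
       (\<forall>s\<in>arc_domain l.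
         complex_of_real (psi_tilde l s) =
           - complex_of_real (W / c * (sqrt 2 / (sqrt (1 + c\<^sup>2) * sqrt (1 - d)))) * (1 / \<i>) *
             (elliptic_F (\<i> * complex_of_real (s + \<phi> / 2)) M -
              elliptic_F (\<i> * complex_of_real \<phi> / 2) M -
              (1 - 1 / D) *
                (elliptic_Pi (M / D) (\<i> * complex_of_real (s + \<phi> / 2)) M -
                 elliptic_Pi (M / D) (\<i> * complex_of_real \<phi> / 2) M))) \<and>
       (\<forall>s\<in>arc_domain l. \<bar>psi_tilde l s\<bar> < pi) \<and>
       (\<forall>s\<in>arc_domain l. 0 < s \<longrightarrow> sgn (psi_tilde l s) = sgn W)))"
proof -
  interpret spatial_geodesic l x R
    by unfold_locales (rule l1[rule_format] l2[rule_format] l4[rule_format] l5[rule_format]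
        l3[rule_format, unfolded power2_abs] nonzero normalized[rule_format] geodesic | assumption)+
  have generic: "generic_momentum_curve l" if "lam1 l 0 \<noteq> lam2 l 0" "lam1 l 0 \<noteq> - lam2 l 0"
    using that by unfold_locales
  \<comment> \<open>The bound is also claimed for \<open>lam1 l 0 = - lam2 l 0\<close>, where
    \<open>d\<close> is 0.\<close>
  have "d_const l \<le> 1" if "lam1 l 0 \<noteq> lam2 l 0"
  proof (cases "lam1 l 0 = - lam2 l 0")
    case True
    then show ?thesis by (simp add: d_const_def)
  next
    case False
    show ?thesis
      using generic_momentum_curve.d_less_1[OF generic[OF that False]] by simp
  qed
  then show ?thesis
    unfolding Let_def
  proof (intro conjI ballI impI, goal_cases)
    case 1
    show ?case by (rule rotation_R_tilde)
  next
    case (2 s)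
    then show ?case by (intro spatial_part)
  next
    case 3
    then show ?case by blast
  next
    case (4 s)
    then show ?case by (intro generic_momentum_curve.x_tilde_elliptic generic) blast+
  next
    case (5 s)
    then show ?case
      by (intro generic_momentum_curve.psi_tilde_elliptic generic_if_W_nonzero) blast+
  next
    case (6 s)
    then show ?case
      by (intro generic_momentum_curve.psi_tilde_abs_less_pi generic_if_W_nonzero) blast+
  next
    case (7 s)
    then show ?case
      by (intro generic_momentum_curve.sgn_psi_tilde generic_if_W_nonzero) blast+
  qed
qed

end
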